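(* Let $\mathcal X\subseteq\mathbb R^{d_x}$, $\mathcal Y\subseteq\mathbb R^{d_y}$, $\mathcal Z\subseteq\mathbb R^{d_z}$ be nonempty Polish subspaces (with the relative Euclidean topology), $\mathcal Z$ closed, and let $(X,Y)$ be a random vector with values in $\mathcal X\times\mathcal Y$, joint distribution $P$, marginal $P_X$ of $X$ and conditional distributions $P_{Y|X=x}$. Fix $p\ge1$. Assume: (1) $\rho^{(1)},\rho^{(2)},\rho^{\mathrm{EA}}:L^p\to\mathbb R$ are law-invariant convex risk measures; (2) $\widetilde{\mathcal G}$ is the set of all continuous functions $g:\mathcal X\to\mathcal Z$; (3) the cost function $c(z,y)$ is continuous in $(z,y)$, and there exist $\iota\ge0$ and a locally bounded non-negative function $\eta:\mathcal Z\to\mathbb R$ with $|c(z,y)|\le\eta(z)(\|y\|^\iota+1)$ for all $(z,y)\in\mathcal Z\times\mathcal Y$; (4) $x\mapsto P_{Y|X=x}$ is continuous on $\mathcal X$ with respect to the $\|\cdot\|^{\iota p}$-weak topology; (5) for every $\hat x\in\mathcal X$ there exist $\kappa\in\mathbb R$ and a compact set $\hat{\mathcal Z}\subset\mathcal Z$ such that for every $x$ in a neighborhood of $\hat x$ the level set $\{z\in\mathcal Z:\rho^{(2)}_{P_{Y|X=x}}(c(z,Y))\le\kappa\}$ is nonempty and contained in $\hat{\mathcal Z}$; (6) for each $x\in\mathcal X$ the problem $$\text{(C)}\qquad \min_{z\in\mathcal Z}\rho^{(2)}_{P_{Y|X=x}}(c(z,Y))$$ has a unique optimal solution. Consider also the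 problems $$\text{(EA)}\quad \min_{g\in\widetilde{\mathcal G}}\rho^{\mathrm{EA}}_P\big(c(g(X),Y)\big),\qquad\text{(EP)}\quad\min_{g\in\widetilde{\mathcal G}}\rho^{(1)}_{P_X}\Big(\rho^{(2)}_{P_{Y|X}}\big(c(g(X),Y)\big)\Big).$$ Then: (i) The optimal solution mapping $z^*(x):=\arg\min_{z\in\mathcal Z}\rho^{(2)}_{P_{Y|X=x}}(c(z,Y))$ is continuous in $x\in\mathcal X$. (ii) If $\rho^{\mathrm{EA}}_P$ is contextually consistent with $\rho^{(2)}_{P_{Y|X}}$, then (EA) has an optimal solution. If moreover $\rho^{\mathrm{EA}}_P$ is strictly contextually consistent with $\rho^{(2)}_{P_{Y|X}}$, then any optimal policy $g^*$ of (EA) is optimal for (C) in almost every context, i.e. $g^*(x)\in\arg\min_{z\in\mathcal Z}\rho^{(2)}_{P_{Y|X=x}}(c(z,Y))$ for $P_X$-almost every $x\in\mathcal X$. (iii) (EP) has an optimal solution. If moreover $\rho^{(1)}_{P_X}$ is strictly monotone, then any optimal policy $g^*$ of (EP) satisfies $g^*(x)\in\arg\min_{z\in\mathcal Z}\rho^{(2)}_{P_{Y|X=x}}(c(z,Y))$ for $P_X$-almost every $x\in\mathcal X$.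
   Context: Risk measures. $L^p$ is the space of real random variables with finite $p$-th moment on a nonatomic probability space. A map $\rho:L^p\to\mathbb R$ is a convex risk measure if it is monotone ($\xi\ge\zeta$ a.s. implies $\rho(\xi)\ge\rho(\zeta)$), cash invariant ($\rho(\xi+a)=\rho(\xi)+a$ for $a\in\mathbb R$), and convex. It is strictly monotone if $\rho(\xi)>\rho(\zeta)$ whenever $\xi\ge\zeta$ a.s. and $\xi>\zeta$ with positive probability. It is law invariant if $\rho(\xi)=\rho(\zeta)$ whenever $\xi,\zeta$ have the same distribution; then it induces a functional $\varrho$ on the set $\mathcal M_1^p$ of probability measures on $\mathbb R$ with finite $p$-th moment, $\varrho(\mu)=\rho(F_\mu^{-1}(U))$, where $U$ is uniform on $[0,1]$ and $F_\mu^{-1}$ is the quantile function of $\mu$. For a probability measure $Q$ (the law of a random element $W$) and a measurable real function $\phi$ with $Q\circ\phi^{-1}\in\mathcal M_1^p$, write $\rho_Q(\phi(W)):=\varrho(Q\circ\phi^{-1})$. Thus $\rho^{(2)}_{P_{Y|X}}(c(g(X),Y))$ is the random variable $\psi_g(X)$ with $\psi_g(x)=\rho^{(2)}_{P_{Y|X=x}}(c(g(x),Y))$, and $\rho^{(1)}_{P_X}$ is then applied to $\psi_g(X)$. Convention: the random variables to which $\rho^{\mathrm{EA}}_P$ and $\rho^{(1)}_{P_X}$ are applied, namely $c(g(X),Y)$ and $\psi_g(X)$ for $g\in\widetilde{\mathcal G}$, are assumed to have finite $p$-th moment, so that the objectives of (EA) and (EP) are well defined. Contextual consistency. $\rho^{\mathrm{EA}}_P$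 is contextually consistent with $\rho^{(2)}_{P_{Y|X}}$ if for any joint distribution $P$ of $(X,Y)$, any continuous cost function $c(z,y)$ and any continuous policies $g_1,g_2:\mathcal X\to\mathcal Z$ satisfying $$\rho^{(2)}_{P_{Y|X=x}}(c(g_1(x),Y))\le\rho^{(2)}_{P_{Y|X=x}}(c(g_2(x),Y))\quad\text{for almost every }x\in\mathcal X,\tag{A}$$ one has $$\rho^{\mathrm{EA}}_P(c(g_1(X),Y))\le\rho^{\mathrm{EA}}_P(c(g_2(X),Y)).\tag{B}$$ It is strictly contextually consistent if, additionally, the inequality in (B) is strict whenever the inequality in (A) is strict on a set of $x$ of strictly positive probability. $\|\cdot\|^{q}$-weak topology ($q\ge 0$). On the set $\mathcal M^q_d$ of probability measures on $\mathbb R^d$ with $\int\|t\|^q\,P(dt)<\infty$, it is the coarsest topology making $P\mapsto\int h\,dP$ continuous for every continuous $h:\mathbb R^d\to\mathbb R$ satisfying $|h(t)|\le c_0(\|t\|^q+1)$ for all $t$ and some constant $c_0>0$. *)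

theory Defs
  imports "HOL-Probability.Probability"
begin

definition nonatomic :: "'w measure \<Rightarrow> bool" where
  "nonatomic M \<longleftrightarrow>
     (\<forall>A\<in>sets M. 0 < measure M A \<longrightarrow>
        (\<exists>B\<in>sets M. B \<subseteq> A \<and> 0 < measure M B \<and> measure M B < measure M A))"

text \<open>Random variables are not identified when they agree almost surely; a monotone functional
  in the sense below nevertheless takes equal values on them.\<close>

definition Lp :: "'w measure \<Rightarrow> real \<Rightarrow> ('w \<Rightarrow> real) set" where
  "Lp M p = {\<xi> \<in> borel_measurable M. integrable M (\<lambda>\<omega>. \<bar>\<xi> \<omega>\<bar> powr p)}"

definition convex_risk_measure :: "'w measure \<Rightarrow> real \<Rightarrow> (('w \<Rightarrow> real) \<Rightarrow> real) \<Rightarrow> bool" where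
  "convex_risk_measure M p \<rho> \<longleftrightarrow>
     (\<forall>\<xi>\<in>Lp M p. \<forall>\<zeta>\<in>Lp M p. (AE \<omega> in M. \<zeta> \<omega> \<le> \<xi> \<omega>) \<longrightarrow> \<rho> \<zeta> \<le> \<rho> \<xi>) \<and>
     (\<forall>\<xi>\<in>Lp M p. \<forall>a. \<rho> (\<lambda>\<omega>. \<xi> \<omega> + a) = \<rho> \<xi> + a) \<and>
     (\<forall>\<xi>\<in>Lp M p. \<forall>\<zeta>\<in>Lp M p. \<forall>t. 0 \<le> t \<and> t \<le> 1 \<longrightarrow>
        \<rho> (\<lambda>\<omega>. t * \<xi> \<omega> + (1 - t) * \<zeta> \<omega>) \<le> t * \<rho> \<xi> + (1 - t) * \<rho> \<zeta>)"

definition strictly_monotone :: "'w measure \<Rightarrow> real \<Rightarrow> (('w \<Rightarrow> real) \<Rightarrow> real) \<Rightarrow> bool" where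
  "strictly_monotone M p \<rho> \<longleftrightarrow>
     (\<forall>\<xi>\<in>Lp M p. \<forall>\<zeta>\<in>Lp M p.
        (AE \<omega> in M. \<zeta> \<omega> \<le> \<xi> \<omega>) \<and> 0 < measure M {\<omega>\<in>space M. \<zeta> \<omega> < \<xi> \<omega>} \<longrightarrow> \<rho> \<zeta> < \<rho> \<xi>)"

definition law_invariant :: "'w measure \<Rightarrow> real \<Rightarrow> (('w \<Rightarrow> real) \<Rightarrow> real) \<Rightarrow> bool" where
  "law_invariant M p \<rho> \<longleftrightarrow>
     (\<forall>\<xi>\<in>Lp M p. \<forall>\<zeta>\<in>Lp M p. distr M borel \<xi> = distr M borel \<zeta> \<longrightarrow> \<rho> \<xi> = \<rho> \<zeta>)"

text \<open>Outside \<open>0 < u < 1\<close> the infimum may be over the empty set or an unbounded set and is then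
  a constant without meaning; a uniform random variable takes such values with probability zero.\<close>

definition quantile :: "real measure \<Rightarrow> real \<Rightarrow> real" where
  "quantile \<mu> u = Inf {t. u \<le> cdf \<mu> t}"

text \<open>A uniform random variable exists on every nonatomic probability space.  The choice is
  immaterial for a law-invariant functional.\<close>

definition uniform_rv :: "'w measure \<Rightarrow> 'w \<Rightarrow> real" where
  "uniform_rv M = (SOME U. U \<in> borel_measurable M \<and> distr M borel U = uniform_measure lborel {0..1})"

definition induced_functional :: "'w measure \<Rightarrow> (('w \<Rightarrow> real) \<Rightarrow> real) \<Rightarrow> real measure \<Rightarrow> real" where
  "induced_functional M \<rho> \<mu> = \<rho> (\<lambda>\<omega>. quantile \<mu> (uniform_rv M \<omega>))"

text \<open>\<open>\<rho>\<^sub>Q(\<phi>(W))\<close>, meaningful for \<open>\<phi> \<in> Lp Q p\<close>.\<close>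

definition risk_under :: "'w measure \<Rightarrow> (('w \<Rightarrow> real) \<Rightarrow> real) \<Rightarrow> 'b measure \<Rightarrow> ('b \<Rightarrow> real) \<Rightarrow> real" where
  "risk_under M \<rho> Q \<phi> = induced_functional M \<rho> (distr Q borel \<phi>)"

text \<open>Laws of elements of a subset \<open>S\<close> of a Euclidean space live on the Borel sets of \<open>S\<close> itself,
  since cost functions and policies are only constrained on the respective subsets.\<close>

abbreviation borel_on :: "'a::topological_space set \<Rightarrow> 'a measure" where
  "borel_on S \<equiv> restrict_space borel S"

definition fst_marginal :: "'a::topological_space set \<Rightarrow> ('a \<times> 'b) measure \<Rightarrow> 'a measure" where
  "fst_marginal \<X> P = distr P (borel_on \<X>) fst"

definition conditional_distribution ::
  "'a::topological_space set \<Rightarrow> 'b::topological_space set \<Rightarrow> ('a \<times> 'b) measure \<Rightarrow> ('a \<Rightarrow> 'b measure) \<Rightarrow> bool"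
  where
  "conditional_distribution \<X> \<Y> P K \<longleftrightarrow>
     K \<in> borel_on \<X> \<rightarrow>\<^sub>M prob_algebra (borel_on \<Y>) \<and>
     (\<forall>A\<in>sets (borel_on \<X>). \<forall>B\<in>sets (borel_on \<Y>).
        emeasure P (A \<times> B) = (\<integral>\<^sup>+x\<in>A. emeasure (K x) B \<partial>fst_marginal \<X> P))"

definition policies :: "'a::topological_space set \<Rightarrow> 'c::topological_space set \<Rightarrow> ('a \<Rightarrow> 'c) set" where
  "policies \<X> \<Z> = {g. continuous_on \<X> g \<and> g ` \<X> \<subseteq> \<Z>}"

text \<open>The spaces \<open>\<X>\<close>, \<open>\<Y>\<close>, \<open>\<Z>\<close> are fixed, whereas the joint distribution, the cost function and the
  policies vary.  The \<open>Lp\<close> conditions say that \<open>\<rho>\<^sup>E\<^sup>A\<^sub>P(c(g\<^sub>i(X),Y))\<close> is defined; by Fubini's theorem they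
  also make the conditional risks defined for almost every \<open>x\<close>.\<close>

definition contextually_dominated ::
  "'w measure \<Rightarrow> real \<Rightarrow> 'a::topological_space set \<Rightarrow> 'b::topological_space set \<Rightarrow> 'c::topological_space set \<Rightarrow>
   (('w \<Rightarrow> real) \<Rightarrow> real) \<Rightarrow> ('a \<times> 'b) measure \<Rightarrow> ('a \<Rightarrow> 'b measure) \<Rightarrow> ('c \<Rightarrow> 'b \<Rightarrow> real) \<Rightarrow>
   ('a \<Rightarrow> 'c) \<Rightarrow> ('a \<Rightarrow> 'c) \<Rightarrow> bool" where
  "contextually_dominated M p \<X> \<Y> \<Z> \<rho>2 P K c g1 g2 \<longleftrightarrow>
     prob_space P \<and> sets P = sets (borel_on \<X> \<Otimes>\<^sub>M borel_on \<Y>) \<and>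
     conditional_distribution \<X> \<Y> P K \<and>
     continuous_on (\<Z> \<times> \<Y>) (\<lambda>(z, y). c z y) \<and>
     g1 \<in> policies \<X> \<Z> \<and> g2 \<in> policies \<X> \<Z> \<and>
     (\<lambda>(x, y). c (g1 x) y) \<in> Lp P p \<and> (\<lambda>(x, y). c (g2 x) y) \<in> Lp P p \<and>
     (AE x in fst_marginal \<X> P.
        risk_under M \<rho>2 (K x) (c (g1 x)) \<le> risk_under M \<rho>2 (K x) (c (g2 x)))"

definition contextually_consistent ::
  "'w measure \<Rightarrow> real \<Rightarrow> 'a::topological_space set \<Rightarrow> 'b::topological_space set \<Rightarrow> 'c::topological_space set \<Rightarrow>
   (('w \<Rightarrow> real) \<Rightarrow> real) \<Rightarrow> (('w \<Rightarrow> real) \<Rightarrow> real) \<Rightarrow> bool" where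
  "contextually_consistent M p \<X> \<Y> \<Z> \<rho>EA \<rho>2 \<longleftrightarrow>
     (\<forall>P K c g1 g2. contextually_dominated M p \<X> \<Y> \<Z> \<rho>2 P K c g1 g2 \<longrightarrow>
        risk_under M \<rho>EA P (\<lambda>(x, y). c (g1 x) y) \<le> risk_under M \<rho>EA P (\<lambda>(x, y). c (g2 x) y))"

definition strictly_contextually_consistent ::
  "'w measure \<Rightarrow> real \<Rightarrow> 'a::topological_space set \<Rightarrow> 'b::topological_space set \<Rightarrow> 'c::topological_space set \<Rightarrow>
   (('w \<Rightarrow> real) \<Rightarrow> real) \<Rightarrow> (('w \<Rightarrow> real) \<Rightarrow> real) \<Rightarrow> bool" where
  "strictly_contextually_consistent M p \<X> \<Y> \<Z> \<rho>EA \<rho>2 \<longleftrightarrow>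
     contextually_consistent M p \<X> \<Y> \<Z> \<rho>EA \<rho>2 \<and>
     (\<forall>P K c g1 g2. contextually_dominated M p \<X> \<Y> \<Z> \<rho>2 P K c g1 g2 \<and>
        (\<exists>A\<in>sets (fst_marginal \<X> P). 0 < emeasure (fst_marginal \<X> P) A \<and>
           (\<forall>x\<in>A. risk_under M \<rho>2 (K x) (c (g1 x)) < risk_under M \<rho>2 (K x) (c (g2 x)))) \<longrightarrow>
        risk_under M \<rho>EA P (\<lambda>(x, y). c (g1 x) y) < risk_under M \<rho>EA P (\<lambda>(x, y). c (g2 x) y))"

definition polish_subspace :: "'a::topological_space set \<Rightarrow> bool" where
  "polish_subspace S \<longleftrightarrow> completely_metrizable_space (top_of_set S) \<and> separable_space (top_of_set S)"

definition locally_bounded_on :: "'a::topological_space set \<Rightarrow> ('a \<Rightarrow> real) \<Rightarrow> bool" where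
  "locally_bounded_on S f \<longleftrightarrow>
     (\<forall>s\<in>S. \<exists>U. openin (top_of_set S) U \<and> s \<in> U \<and> bounded (f ` U))"

text \<open>For \<open>q = 0\<close>, \<open>powr\<close> gives \<open>0\<close> instead of \<open>1\<close> at the origin.  This affects neither
  integrability nor, up to doubling the constant, a bound by a multiple of \<open>norm t powr q + 1\<close>.\<close>

definition moment_measures :: "real \<Rightarrow> 'b::euclidean_space measure set" where
  "moment_measures q =
     {\<mu>. sets \<mu> = sets borel \<and> prob_space \<mu> \<and> integrable \<mu> (\<lambda>t. norm t powr q)}"

definition growth_functions :: "real \<Rightarrow> ('b::euclidean_space \<Rightarrow> real) set" where
  "growth_functions q =
     {h. continuous_on UNIV h \<and> (\<exists>c0>0. \<forall>t. \<bar>h t\<bar> \<le> c0 * (norm t powr q + 1))}"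

definition norm_weak_topology :: "real \<Rightarrow> 'b::euclidean_space measure topology" where
  "norm_weak_topology q =
     topology_generated_by
       {{\<mu> \<in> moment_measures q. (\<integral>t. h t \<partial>\<mu>) \<in> U} | h U. h \<in> growth_functions q \<and> open U}"

text \<open>A measure on the Borel sets of a subset, regarded as a measure on the whole space.\<close>

definition extend_to_borel :: "'b::topological_space measure \<Rightarrow> 'b measure" where
  "extend_to_borel \<mu> = distr \<mu> borel (\<lambda>y. y)"

end

theory Submission
  imports Defs
begin

text \<open>
  Everything rests on the joint continuity of \<open>R x z = \<rho>2(c(z, Y))\<close> under \<open>P\<close> given \<open>X = x\<close>.  A Fatou
  lemma for simultaneously varying measures and integrands, proved by approximating the integrands
  from below with Lipschitz functions, shows that the laws of \<open>c(z, Y)\<close> converge weakly together with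
  their \<open>p\<close>-th moments when \<open>x\<close> and \<open>z\<close> vary.  Hence the quantile functions, evaluated at a uniform
  random variable, converge in \<open>L\<^sup>p\<close>, and a finite convex monotone functional on \<open>L\<^sup>p\<close> is
  norm-continuous.  Compact level sets and uniqueness then make the minimiser \<open>z\<^sup>*\<close> continuous, so it is
  a policy, and pointwise it is at least as good as any other policy.  Comparing with \<open>z\<^sup>*\<close> gives
  (ii) directly and (iii) through the monotonicity of quantiles; in the strict case, ordered quantile
  functions that agree almost surely force equal laws, hence equal means, hence equality almost surely.
\<close>

section \<open>Integrals with varying measures and integrands\<close>

text \<open>The integrand \<open>c (zs n)\<close> is controlled only on \<open>\<Y>\<close>, which
  need not be closed, whereas weak convergence is tested by functions on the whole space. Infimal
  convolutions bridge this gap because they are defined everywhere, so \<open>c\<close> is never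
  extended. The growth condition gives no constant bound either, but a weight depending on y alone
  whose integrals converge with the kernel; adding the integrand to this weight and subtracting it
  from the weight makes Fatou's lemma two-sided. The risk of a law is computed on \<open>M\<close>
  with a uniform variable picked by \<open>SOME\<close>, and this choice has content only once such
  a variable has been constructed from nonatomicity. Using one variable for all laws couples them:
  comparison and convergence of laws carried by different spaces become almost sure statements on
  \<open>M\<close>, where the axioms of a risk measure apply.\<close>

lemma inf_convolution_lsc:
  fixes f :: "nat \<Rightarrow> 'b::metric_space \<Rightarrow> real"
  assumes "S \<noteq> {}" and nonneg: "\<And>n y. y \<in> S \<Longrightarrow> 0 \<le> f n y"
    and low: "\<And>y a. y \<in> S \<Longrightarrow> a < g y \<Longrightarrow>
      \<forall>\<^sub>F (n, y') in sequentially \<times>\<^sub>F inf (nhds y) (principal S). a < f n y'"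
  obtains F :: "nat \<Rightarrow> 'b \<Rightarrow> real"
  where "\<And>m. continuous_on UNIV (F m)" "\<And>m y. 0 \<le> F m y" "\<And>m y. F m y \<le> real m"
    "\<And>m n y. y \<in> S \<Longrightarrow> m \<le> n \<Longrightarrow> F m y \<le> f n y"
    "\<And>y. incseq (\<lambda>m. F m y)"
    "\<And>y a. y \<in> S \<Longrightarrow> a < g y \<Longrightarrow> \<exists>m. a \<le> F m y"
proof -
  \<comment> \<open>The infimum below runs over \<open>y' \<in> S\<close> while \<open>y\<close> is
    arbitrary, so \<open>F m\<close> lives on the whole space. Ranging over all n \<ge> m lets the
    single function \<open>F m\<close> minorise the entire tail of \<open>f\<close>; the penalty of
    slope m makes it Lipschitz and the cap m makes it bounded.\<close>
  define h where "h m y = (\<lambda>(n, y'). min (real m) (f n y' + real m * dist y y'))" for m y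
  define F where "F m y = (INF i\<in>{m..} \<times> S. h m y i)" for m y
  have ne: "{m..} \<times> S \<noteq> {}" for m :: nat using \<open>S \<noteq> {}\<close> by auto
  have h0: "0 \<le> h m y i" if "i \<in> {k..} \<times> S" for m k y i
    using that nonneg by (auto simp: h_def)
  have bdd: "bdd_below (h m y ` ({k..} \<times> S))" for m k y
    by (rule bdd_belowI2[of _ 0]) (rule h0)
  have le: "F m y \<le> h m y (n, y')" if "m \<le> n" "y' \<in> S" for m y n y'
    unfolding F_def by (rule cINF_lower[OF bdd]) (use that in auto)
  obtain y0 where y0: "y0 \<in> S" using \<open>S \<noteq> {}\<close> by auto
  have lip: "F m x \<le> F m y + real m * dist x y" for m x y
  proof -
    have "F m x - real m * dist x y \<le> F m y"
      unfolding F_def[of m y]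
    proof (rule cINF_greatest[OF ne])
      fix i assume i: "i \<in> {m..} \<times> S"
      obtain n y' where [simp]: "i = (n, y')" by force
      have "F m x \<le> h m x (n, y')" using i by (intro le) auto
      moreover have "real m * dist x y' \<le> real m * dist y y' + real m * dist x y"
        by (metis add.commute distrib_left dist_triangle mult_left_mono of_nat_0_le_iff)
      moreover have "0 \<le> real m * dist x y" by simp
      ultimately show "F m x - real m * dist x y \<le> h m y i"
        unfolding h_def by (simp only: \<open>i = (n, y')\<close> prod.case)
    qed
    then show ?thesis by simp
  qed
  show thesis
  proof (rule that[of F])
    fix m :: nat
    have "lipschitz_on (real m) UNIV (F m)"
    proof (rule lipschitz_onI)
      fix x y show "dist (F m x) (F m y) \<le> real m * dist x y"
        using lip[of m x y] lip[of m y x] by (simp add: dist_real_def abs_le_iff dist_commute)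
    qed simp
    then show "continuous_on UNIV (F m)" by (rule lipschitz_on_continuous_on)
  next
    fix m y show "0 \<le> F m y" unfolding F_def using h0 by (intro cINF_greatest[OF ne]) auto
  next
    fix m y show "F m y \<le> real m" using le[OF order_refl y0, of m y] by (simp add: h_def)
  next
    fix m n :: nat and y assume "y \<in> S" "m \<le> n" then show "F m y \<le> f n y"
      using le[of m n y y] by (simp add: h_def)
  next
    fix y show "incseq (\<lambda>m. F m y)"
    proof (rule monoI)
      fix m m' :: nat assume m: "m \<le> m'"
      \<comment> \<open>As m grows, the index set shrinks while cap and slope increase.\<close>
      show "F m y \<le> F m' y" unfolding F_def[of m']
      proof (rule cINF_greatest[OF ne])
        fix i assume i: "i \<in> {m'..} \<times> S"
        obtain n y' where [simp]: "i = (n, y')" by force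
        have "F m y \<le> h m y (n, y')" using i m by (intro le) auto
        also have "\<dots> \<le> h m' y i" using m
          by (simp only: h_def \<open>i = (n, y')\<close> prod.case)
            (intro min.mono add_left_mono mult_right_mono, auto)
        finally show "F m y \<le> h m' y i" .
      qed
    qed
  next
    fix y a assume y: "y \<in> S" "a < g y"
    obtain N Q where Q: "eventually Q (inf (nhds y) (principal S))"
      and QN: "\<And>n y'. N \<le> n \<Longrightarrow> Q y' \<Longrightarrow> a < f n y'"
      using low[OF y] unfolding eventually_prod_filter eventually_sequentially by fastforce
    obtain d where d: "0 < d" "\<And>y'. y' \<in> S \<Longrightarrow> dist y' y < d \<Longrightarrow> Q y'"
      using Q unfolding eventually_inf_principal eventually_nhds_metric by auto
    \<comment> \<open>Three demands on m: m \<ge> N confines the indices to the tail where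
      \<open>QN\<close> applies, m \<ge> a keeps the cap out of the way, and m \<ge> a / d makes the
      penalty alone reach a at distance at least d, where only \<open>0 \<le> f n y'\<close> is
      known.\<close>
    obtain m :: nat where m: "max (real N) (max a (a / d)) \<le> real m"
      using real_arch_simple by blast
    have "a \<le> F m y" unfolding F_def
    proof (rule cINF_greatest[OF ne])
      fix i assume i: "i \<in> {m..} \<times> S"
      obtain n y' where [simp]: "i = (n, y')" by force
      have y': "y' \<in> S" "m \<le> n" using i by auto
      show "a \<le> h m y i"
      proof (cases "dist y y' < d")
        case True
        then have "a < f n y'" using QN[of n y'] d(2)[of y'] y' m by (simp add: dist_commute)
        then have "a \<le> f n y' + real m * dist y y'" by (simp add: add_increasing2 less_imp_le)
        with m show ?thesis by (simp add: h_def)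
      next
        case False
        have "a \<le> real m * d" using m d(1) by (simp add: field_simps)
        also have "\<dots> \<le> real m * dist y y'" using False by (intro mult_left_mono) auto
        finally have "a \<le> real m * dist y y'" .
        with nonneg[OF y'(1), of n] m show ?thesis by (simp add: h_def)
      qed
    qed
    then show "\<exists>m. a \<le> F m y" ..
  qed
qed

lemma borel_on_measurable:
  "f \<in> borel_measurable borel \<Longrightarrow> sets \<mu> = sets (borel_on S) \<Longrightarrow> f \<in> borel_measurable \<mu>"
  by (simp add: measurable_cong_sets[where M=\<mu>, OF _ refl] measurable_restrict_space1)

text \<open>For fixed m the minorant \<open>F m\<close> is bounded and continuous, so its integrals
  converge although the measures vary, and they stay below those of \<open>f n\<close> once n \<ge>
  m. Monotone convergence under the limit measure then lets m grow.\<close>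

lemma fatou_varying_measures:
  fixes f :: "nat \<Rightarrow> 'b::euclidean_space \<Rightarrow> real"
  assumes sets: "\<And>n. sets (\<mu>s n) = sets (borel_on S)" "sets \<mu> = sets (borel_on S)"
    and prob: "\<And>n. prob_space (\<mu>s n)" "prob_space \<mu>"
    and weak: "\<And>h B. continuous_on UNIV h \<Longrightarrow> (\<And>y. \<bar>h y\<bar> \<le> B) \<Longrightarrow>
      (\<lambda>n. \<integral>y. h y \<partial>\<mu>s n) \<longlonglongrightarrow> (\<integral>y. (h y :: real) \<partial>\<mu>)"
    and nonneg: "\<And>n y. y \<in> S \<Longrightarrow> 0 \<le> f n y"
    and low: "\<And>y a. y \<in> S \<Longrightarrow> a < g y \<Longrightarrow>
      \<forall>\<^sub>F (n, y') in sequentially \<times>\<^sub>F inf (nhds y) (principal S). a < f n y'"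
  shows "(\<integral>\<^sup>+y. ennreal (g y) \<partial>\<mu>) \<le> liminf (\<lambda>n. \<integral>\<^sup>+y. ennreal (f n y) \<partial>\<mu>s n)"
proof -
  have sp: "space (\<mu>s n) = S" "space \<mu> = S" for n
    using sets_eq_imp_space_eq[OF sets(1)] sets_eq_imp_space_eq[OF sets(2)]
    by (auto simp: space_restrict_space)
  have "S \<noteq> {}" using prob_space.not_empty[OF prob(2)] sp by simp
  then obtain F where F: "\<And>m. continuous_on UNIV (F m)" "\<And>m y. 0 \<le> F m y" "\<And>m y. F m y \<le> real m"
    "\<And>m n y. y \<in> S \<Longrightarrow> m \<le> n \<Longrightarrow> F m y \<le> f n y" "\<And>y. incseq (\<lambda>m. F m y)"
    "\<And>y a. y \<in> S \<Longrightarrow> a < g y \<Longrightarrow> \<exists>m. a \<le> F m y"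
    using inf_convolution_lsc[of S f g] nonneg low by metis
  have Fm: "F m \<in> borel_measurable borel" for m
    using F(1) by (rule borel_measurable_continuous_onI)
  have meas[measurable]: "F m \<in> borel_measurable (\<mu>s n)" "F m \<in> borel_measurable \<mu>" for m n
    using sets Fm by (auto intro: borel_on_measurable)
  have int: "integrable (\<mu>s n) (F m)" "integrable \<mu> (F m)" for m n
    using F(2,3) prob by (auto intro!: finite_measure.integrable_const_bound[where B="real m"] prob_space.finite_measure)
  have "(\<integral>\<^sup>+y. ennreal (g y) \<partial>\<mu>) \<le> (\<integral>\<^sup>+y. (SUP m. ennreal (F m y)) \<partial>\<mu>)"
  proof (rule nn_integral_mono)
    fix y assume "y \<in> space \<mu>"
    then have y: "y \<in> S" using sp by simp
    show "ennreal (g y) \<le> (SUP m. ennreal (F m y))"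
    proof (rule dense_le)
      fix b assume b: "b < ennreal (g y)"
      then have "b \<noteq> \<top>" by auto
      then obtain a where a: "b = ennreal a" "0 \<le> a" by (cases b) auto
      with b have "a < g y" using ennreal_less_iff by blast
      then obtain m where "a \<le> F m y" using F(6)[OF y] by blast
      then show "b \<le> (SUP m. ennreal (F m y))"
        using a by (auto intro: SUP_upper2[of m] ennreal_leI)
    qed
  qed
  also have "\<dots> = (SUP m. \<integral>\<^sup>+y. ennreal (F m y) \<partial>\<mu>)"
    using F(5) by (intro nn_integral_monotone_convergence_SUP)
      (auto simp: incseq_def le_fun_def intro!: ennreal_leI)
  also have "\<dots> \<le> liminf (\<lambda>n. \<integral>\<^sup>+y. ennreal (f n y) \<partial>\<mu>s n)"
  proof (rule SUP_least)
    fix m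
    have "(\<lambda>n. \<integral>y. F m y \<partial>\<mu>s n) \<longlonglongrightarrow> (\<integral>y. F m y \<partial>\<mu>)"
      using F by (intro weak[of _ "real m"]) auto
    then have "(\<lambda>n. ennreal (\<integral>y. F m y \<partial>\<mu>s n)) \<longlonglongrightarrow> ennreal (\<integral>y. F m y \<partial>\<mu>)"
      by (rule tendsto_ennrealI)
    then have "(\<integral>\<^sup>+y. ennreal (F m y) \<partial>\<mu>) = liminf (\<lambda>n. \<integral>\<^sup>+y. ennreal (F m y) \<partial>\<mu>s n)"
      using int F(2) by (simp add: nn_integral_eq_integral lim_imp_Liminf[OF trivial_limit_sequentially, symmetric])
    also have "\<dots> \<le> liminf (\<lambda>n. \<integral>\<^sup>+y. ennreal (f n y) \<partial>\<mu>s n)"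
    proof (rule Liminf_mono)
      show "\<forall>\<^sub>F n in sequentially. (\<integral>\<^sup>+y. ennreal (F m y) \<partial>\<mu>s n) \<le> (\<integral>\<^sup>+y. ennreal (f n y) \<partial>\<mu>s n)"
        using eventually_ge_at_top[of m]
        by eventually_elim (use F(4) sp in \<open>auto intro!: nn_integral_mono ennreal_leI\<close>)
    qed
    finally show "(\<integral>\<^sup>+y. ennreal (F m y) \<partial>\<mu>) \<le> liminf (\<lambda>n. \<integral>\<^sup>+y. ennreal (f n y) \<partial>\<mu>s n)" .
  qed
  finally show ?thesis .
qed

lemma ennreal_le_liminfD:
  assumes "ennreal c \<le> liminf (\<lambda>n. ennreal (x n))" "\<And>n. 0 \<le> x n" "a < c"
  shows "\<forall>\<^sub>F n in sequentially. a < x n"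
proof (cases "a < 0")
  case True
  then show ?thesis using assms(2) by (auto intro!: always_eventually intro: less_le_trans)
next
  case False
  then have "ennreal a < ennreal c" using assms(3) by (simp add: ennreal_less_iff)
  with assms(1) have "\<forall>\<^sub>F n in sequentially. ennreal a < ennreal (x n)"
    unfolding le_Liminf_iff by blast
  then show ?thesis by eventually_elim (use False in \<open>simp add: ennreal_less_iff\<close>)
qed

text \<open>Fatou's lemma for w + f and w - f bounds the limit from both sides, and the convergence
  of the integrals of w allows w to be subtracted again. The majorant is one function for all n;
  only the measures integrating it change. The sign s treats both cases at once.\<close>

lemma dominated_convergence_varying_measures:
  fixes f :: "nat \<Rightarrow> 'b::euclidean_space \<Rightarrow> real"
  assumes sets: "\<And>n. sets (\<mu>s n) = sets (borel_on S)" "sets \<mu> = sets (borel_on S)"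
    and prob: "\<And>n. prob_space (\<mu>s n)" "prob_space \<mu>"
    and weak: "\<And>h B. continuous_on UNIV h \<Longrightarrow> (\<And>y. \<bar>h y\<bar> \<le> B) \<Longrightarrow>
      (\<lambda>n. \<integral>y. h y \<partial>\<mu>s n) \<longlonglongrightarrow> (\<integral>y. (h y :: real) \<partial>\<mu>)"
    and w: "continuous_on UNIV w" "\<And>n. integrable (\<mu>s n) w" "integrable \<mu> w"
      "(\<lambda>n. \<integral>y. w y \<partial>\<mu>s n) \<longlonglongrightarrow> (\<integral>y. w y \<partial>\<mu>)"
    and meas: "\<And>n. f n \<in> borel_measurable (borel_on S)" "g \<in> borel_measurable (borel_on S)"
    and dom: "\<And>n y. y \<in> S \<Longrightarrow> \<bar>f n y\<bar> \<le> w y" "\<And>y. y \<in> S \<Longrightarrow> \<bar>g y\<bar> \<le> w y"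
    and lim: "\<And>y. y \<in> S \<Longrightarrow>
      ((\<lambda>(n, y'). f n y') \<longlongrightarrow> g y) (sequentially \<times>\<^sub>F inf (nhds y) (principal S))"
  shows "(\<lambda>n. \<integral>y. f n y \<partial>\<mu>s n) \<longlonglongrightarrow> (\<integral>y. g y \<partial>\<mu>)"
proof -
  have sp: "space (\<mu>s n) = S" "space \<mu> = S" for n
    using sets_eq_imp_space_eq[OF sets(1)] sets_eq_imp_space_eq[OF sets(2)]
    by (auto simp: space_restrict_space)
  have m[measurable]: "f n \<in> borel_measurable (\<mu>s n)" "g \<in> borel_measurable \<mu>" for n
    using meas by (simp_all add: measurable_cong_sets[OF sets(1) refl] measurable_cong_sets[OF sets(2) refl])
  have fint: "integrable (\<mu>s n) (f n)" for n
    by (rule Bochner_Integration.integrable_bound[OF w(2)])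
      (auto intro!: AE_I2 order_trans[OF dom(1)] simp: sp)
  have gint: "integrable \<mu> g"
    by (rule Bochner_Integration.integrable_bound[OF w(3)])
      (auto intro!: AE_I2 order_trans[OF dom(2)] simp: sp)
  have snd: "filterlim snd (inf (nhds y) (principal S)) (sequentially \<times>\<^sub>F inf (nhds y) (principal S))"
    for y by (rule filterlim_snd)
  have low: "\<forall>\<^sub>F n in sequentially. a < (\<integral>y. w y + s * f n y \<partial>\<mu>s n)"
    if s: "s = 1 \<or> s = - 1" and a: "a < (\<integral>y. w y + s * g y \<partial>\<mu>)" for s a
  proof -
    have pos: "0 \<le> w y + s * f n y" "0 \<le> w y + s * g y" if "y \<in> S" for n y
      using dom(1)[OF that, of n] dom(2)[OF that] s by auto
    have wlim: "((\<lambda>(n, y'). w y' + s * f n y') \<longlongrightarrow> w y + s * g y)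
        (sequentially \<times>\<^sub>F inf (nhds y) (principal S))" if "y \<in> S" for y
    proof -
      have "(w \<longlongrightarrow> w y) (nhds y)"
        using w(1) by (simp add: continuous_on_eq_continuous_at continuous_at tendsto_at_iff_tendsto_nhds)
      then have "(w \<longlongrightarrow> w y) (inf (nhds y) (principal S))"
        by (rule tendsto_mono[rotated]) simp
      then have "((\<lambda>x. w (snd x)) \<longlongrightarrow> w y) (sequentially \<times>\<^sub>F inf (nhds y) (principal S))"
        by (rule filterlim_compose[OF _ snd])
      from tendsto_add[OF this tendsto_mult[OF tendsto_const[of s] lim[OF that]]]
      show ?thesis by (simp add: case_prod_beta')
    qed
    have "(\<integral>\<^sup>+y. ennreal (w y + s * g y) \<partial>\<mu>)
        \<le> liminf (\<lambda>n. \<integral>\<^sup>+y. ennreal (w y + s * f n y) \<partial>\<mu>s n)"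
    proof (rule fatou_varying_measures[OF sets prob weak])
      fix y b assume "y \<in> S" "b < w y + s * g y"
      then show "\<forall>\<^sub>F (n, y') in sequentially \<times>\<^sub>F inf (nhds y) (principal S). b < w y' + s * f n y'"
        using order_tendstoD(1)[OF wlim] by (simp add: case_prod_beta')
    qed (use pos in auto)
    moreover have "(\<integral>\<^sup>+y. ennreal (w y + s * f n y) \<partial>\<mu>s n) = ennreal (\<integral>y. w y + s * f n y \<partial>\<mu>s n)" for n
      using pos sp w fint by (intro nn_integral_eq_integral) auto
    moreover have "(\<integral>\<^sup>+y. ennreal (w y + s * g y) \<partial>\<mu>) = ennreal (\<integral>y. w y + s * g y \<partial>\<mu>)"
      using pos sp w gint by (intro nn_integral_eq_integral) auto
    ultimately have "ennreal (\<integral>y. w y + s * g y \<partial>\<mu>) \<le> liminf (\<lambda>n. ennreal (\<integral>y. w y + s * f n y \<partial>\<mu>s n))"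
      by simp
    have nn: "0 \<le> (\<integral>y. w y + s * f n y \<partial>\<mu>s n)" for n
      using pos sp by (intro integral_nonneg_AE AE_I2) auto
    show ?thesis
      using \<open>ennreal (\<integral>y. w y + s * g y \<partial>\<mu>) \<le> _\<close> nn a by (rule ennreal_le_liminfD)
  qed
  have conv: "\<forall>\<^sub>F n in sequentially. s * (\<integral>y. g y \<partial>\<mu>) - e < s * (\<integral>y. f n y \<partial>\<mu>s n)"
    if s: "s = 1 \<or> s = - 1" and e: "0 < e" for s e
  proof -
    have 1: "(\<integral>y. w y + s * g y \<partial>\<mu>) = (\<integral>y. w y \<partial>\<mu>) + s * (\<integral>y. g y \<partial>\<mu>)"
      using w gint by simp
    have 2: "(\<integral>y. w y + s * f n y \<partial>\<mu>s n) = (\<integral>y. w y \<partial>\<mu>s n) + s * (\<integral>y. f n y \<partial>\<mu>s n)" for n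
      using w fint by simp
    have "\<forall>\<^sub>F n in sequentially. (\<integral>y. w y \<partial>\<mu>) + s * (\<integral>y. g y \<partial>\<mu>) - e/2 < (\<integral>y. w y \<partial>\<mu>s n) + s * (\<integral>y. f n y \<partial>\<mu>s n)"
      using low[OF s, of "(\<integral>y. w y \<partial>\<mu>) + s * (\<integral>y. g y \<partial>\<mu>) - e/2"] e unfolding 1 2 by simp
    moreover have "\<forall>\<^sub>F n in sequentially. (\<integral>y. w y \<partial>\<mu>s n) < (\<integral>y. w y \<partial>\<mu>) + e/2"
      using order_tendstoD(2)[OF w(4)] e by simp
    ultimately show ?thesis by eventually_elim simp
  qed
  show ?thesis
  proof (rule tendstoI)
    fix e :: real assume "0 < e"
    from conv[OF _ this, of 1] conv[OF _ this, of "- 1"]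
    have "\<forall>\<^sub>F n in sequentially. (\<integral>y. g y \<partial>\<mu>) - e < (\<integral>y. f n y \<partial>\<mu>s n)"
      "\<forall>\<^sub>F n in sequentially. (\<integral>y. f n y \<partial>\<mu>s n) < (\<integral>y. g y \<partial>\<mu>) + e"
      by (auto simp: algebra_simps elim: eventually_mono)
    then show "\<forall>\<^sub>F n in sequentially. dist (\<integral>y. f n y \<partial>\<mu>s n) (\<integral>y. g y \<partial>\<mu>) < e"
      by eventually_elim (auto simp: dist_real_def)
  qed
qed

section \<open>Norm continuity of convex risk measures\<close>

lemma LpD:
  assumes "\<xi> \<in> Lp M p"
  shows Lp_measurable: "\<xi> \<in> borel_measurable M"
    and Lp_integrable: "integrable M (\<lambda>\<omega>. \<bar>\<xi> \<omega>\<bar> powr p)"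
  using assms by (auto simp: Lp_def)

text \<open>Estimating the sum by twice the maximum covers every p \<ge> 0 without convexity; for p
  \<ge> 1 the price is the constant \<open>2 powr p\<close> in place of
  \<open>2 powr (p - 1)\<close>.\<close>

lemma abs_add_powr_le:
  fixes a b p :: real
  assumes "0 \<le> p"
  shows "\<bar>a + b\<bar> powr p \<le> 2 powr p * (\<bar>a\<bar> powr p + \<bar>b\<bar> powr p)"
proof -
  have "\<bar>a + b\<bar> powr p \<le> (2 * max \<bar>a\<bar> \<bar>b\<bar>) powr p"
    using assms by (intro powr_mono2) auto
  also have "\<dots> = 2 powr p * max \<bar>a\<bar> \<bar>b\<bar> powr p" by (simp add: powr_mult)
  also have "\<dots> \<le> 2 powr p * (\<bar>a\<bar> powr p + \<bar>b\<bar> powr p)"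
    by (intro mult_left_mono) (auto simp: max_def)
  finally show ?thesis .
qed

lemma Lp_add:
  assumes "0 \<le> p" "\<xi> \<in> Lp M p" "\<zeta> \<in> Lp M p"
  shows "(\<lambda>\<omega>. \<xi> \<omega> + \<zeta> \<omega>) \<in> Lp M p"
proof -
  note [measurable] = LpD(1)[OF assms(2)] LpD(1)[OF assms(3)]
  have "integrable M (\<lambda>\<omega>. \<bar>\<xi> \<omega> + \<zeta> \<omega>\<bar> powr p)"
    by (rule Bochner_Integration.integrable_bound[of M "\<lambda>\<omega>. 2 powr p * (\<bar>\<xi> \<omega>\<bar> powr p + \<bar>\<zeta> \<omega>\<bar> powr p)"])
      (use assms abs_add_powr_le in \<open>auto intro!: AE_I2 LpD(2)\<close>)
  then show ?thesis by (simp add: Lp_def)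
qed

lemma Lp_cmult:
  assumes "\<xi> \<in> Lp M p"
  shows "(\<lambda>\<omega>. a * \<xi> \<omega>) \<in> Lp M p"
  using assms by (auto simp: Lp_def abs_mult powr_mult)

lemma Lp_diff:
  assumes "0 \<le> p" "\<xi> \<in> Lp M p" "\<zeta> \<in> Lp M p"
  shows "(\<lambda>\<omega>. \<xi> \<omega> - \<zeta> \<omega>) \<in> Lp M p"
  using Lp_add[OF assms(1,2) Lp_cmult[OF assms(3), of "- 1"]] by simp

text \<open>The Riesz--Scheffe argument: Fatou's lemma is applied to
  \<open>2\<^sup>p (\<bar>\<xi> n\<bar>\<^sup>p + \<bar>\<xi>\<bar>\<^sup>p) - \<bar>\<xi> n - \<xi>\<bar>\<^sup>p\<close>.\<close>

lemma Lp_tendsto_of_AE_tendsto: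
  assumes p: "0 < p" and Lp: "\<And>n. \<xi>s n \<in> Lp M p" "\<xi> \<in> Lp M p"
    and AE: "AE \<omega> in M. (\<lambda>n. \<xi>s n \<omega>) \<longlonglongrightarrow> \<xi> \<omega>"
    and int: "(\<lambda>n. \<integral>\<omega>. \<bar>\<xi>s n \<omega>\<bar> powr p \<partial>M) \<longlonglongrightarrow> (\<integral>\<omega>. \<bar>\<xi> \<omega>\<bar> powr p \<partial>M)"
  shows "(\<lambda>n. \<integral>\<omega>. \<bar>\<xi>s n \<omega> - \<xi> \<omega>\<bar> powr p \<partial>M) \<longlonglongrightarrow> 0"
proof -
  note [measurable] = LpD(1)[OF Lp(1)] LpD(1)[OF Lp(2)]
  define h where "h n \<omega> = 2 powr p * (\<bar>\<xi>s n \<omega>\<bar> powr p + \<bar>\<xi> \<omega>\<bar> powr p) - \<bar>\<xi>s n \<omega> - \<xi> \<omega>\<bar> powr p" for n \<omega>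
  define C where "C = (\<integral>\<omega>. \<bar>\<xi> \<omega>\<bar> powr p \<partial>M)"
  have ints: "integrable M (\<lambda>\<omega>. \<bar>\<xi>s n \<omega>\<bar> powr p)" "integrable M (\<lambda>\<omega>. \<bar>\<xi> \<omega>\<bar> powr p)"
    "integrable M (\<lambda>\<omega>. \<bar>\<xi>s n \<omega> - \<xi> \<omega>\<bar> powr p)" for n
    using Lp Lp_diff[of p] p by (auto intro!: LpD(2))
  have hint: "integrable M (h n)" for n unfolding h_def using ints by auto
  have h0: "0 \<le> h n \<omega>" for n \<omega>
    using abs_add_powr_le[of p "\<xi>s n \<omega>" "- \<xi> \<omega>"] p by (simp add: h_def)
  have hI: "(\<integral>\<omega>. h n \<omega> \<partial>M) = 2 powr p * ((\<integral>\<omega>. \<bar>\<xi>s n \<omega>\<bar> powr p \<partial>M) + C) - (\<integral>\<omega>. \<bar>\<xi>s n \<omega> - \<xi> \<omega>\<bar> powr p \<partial>M)" for n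
    unfolding h_def C_def using ints by simp
  have "ennreal (2 powr p * (2 * C)) = (\<integral>\<^sup>+\<omega>. ennreal (2 powr p * (2 * \<bar>\<xi> \<omega>\<bar> powr p)) \<partial>M)"
    unfolding C_def using ints by (subst nn_integral_eq_integral) auto
  also have "\<dots> \<le> (\<integral>\<^sup>+\<omega>. liminf (\<lambda>n. ennreal (h n \<omega>)) \<partial>M)"
  proof (rule nn_integral_mono_AE)
    show "AE \<omega> in M. ennreal (2 powr p * (2 * \<bar>\<xi> \<omega>\<bar> powr p)) \<le> liminf (\<lambda>n. ennreal (h n \<omega>))"
      using AE
    proof eventually_elim
      case (elim \<omega>)
      have "(\<lambda>n. \<bar>\<xi>s n \<omega>\<bar> powr p) \<longlonglongrightarrow> \<bar>\<xi> \<omega>\<bar> powr p"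
        using elim p by (intro tendsto_powr' tendsto_rabs) auto
      moreover have "(\<lambda>n. \<bar>\<xi>s n \<omega> - \<xi> \<omega>\<bar> powr p) \<longlonglongrightarrow> \<bar>\<xi> \<omega> - \<xi> \<omega>\<bar> powr p"
        using elim p by (intro tendsto_powr' tendsto_rabs tendsto_diff) auto
      ultimately have "(\<lambda>n. h n \<omega>) \<longlonglongrightarrow> 2 powr p * (\<bar>\<xi> \<omega>\<bar> powr p + \<bar>\<xi> \<omega>\<bar> powr p) - \<bar>\<xi> \<omega> - \<xi> \<omega>\<bar> powr p"
        unfolding h_def by (intro tendsto_diff tendsto_mult tendsto_add tendsto_const)
      then have "(\<lambda>n. ennreal (h n \<omega>)) \<longlonglongrightarrow> ennreal (2 powr p * (2 * \<bar>\<xi> \<omega>\<bar> powr p))"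
        by (intro tendsto_ennrealI) simp
      then show ?case using lim_imp_Liminf[OF trivial_limit_sequentially] by fastforce
    qed
  qed
  also have "\<dots> \<le> liminf (\<lambda>n. \<integral>\<^sup>+\<omega>. ennreal (h n \<omega>) \<partial>M)"
    by (rule nn_integral_liminf) (simp add: h_def)
  also have "(\<lambda>n. \<integral>\<^sup>+\<omega>. ennreal (h n \<omega>) \<partial>M) = (\<lambda>n. ennreal (\<integral>\<omega>. h n \<omega> \<partial>M))"
    using hint h0 by (simp add: nn_integral_eq_integral)
  finally have le: "ennreal (2 powr p * (2 * C)) \<le> liminf (\<lambda>n. ennreal (\<integral>\<omega>. h n \<omega> \<partial>M))" .
  have lim: "(\<lambda>n. 2 powr p * ((\<integral>\<omega>. \<bar>\<xi>s n \<omega>\<bar> powr p \<partial>M) + C)) \<longlonglongrightarrow> 2 powr p * (C + C)"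
    using int unfolding C_def by (intro tendsto_intros)
  show ?thesis
  proof (rule tendstoI)
    fix e :: real assume e: "0 < e"
    have "\<forall>\<^sub>F n in sequentially. 2 powr p * (2 * C) - e/2 < (\<integral>\<omega>. h n \<omega> \<partial>M)"
      using e h0 by (intro ennreal_le_liminfD[OF le]) auto
    moreover have "\<forall>\<^sub>F n in sequentially. 2 powr p * ((\<integral>\<omega>. \<bar>\<xi>s n \<omega>\<bar> powr p \<partial>M) + C) < 2 powr p * (C + C) + e/2"
      using order_tendstoD(2)[OF lim] e by simp
    ultimately show "\<forall>\<^sub>F n in sequentially. dist (\<integral>\<omega>. \<bar>\<xi>s n \<omega> - \<xi> \<omega>\<bar> powr p \<partial>M) 0 < e"
      by eventually_elim (simp add: hI)
  qed
qed

text \<open>Convexity turns an upper bound into a two-sided one. \<open>\<xi>'\<close> lies below a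
  mixture of \<open>\<xi> + \<zeta>\<close> and \<open>\<xi>\<close>, which bounds
  \<open>\<rho> \<xi>'\<close> from above; conversely \<open>\<xi>\<close> lies below a mixture of
  \<open>\<xi>'\<close> and \<open>\<xi> + \<zeta>\<close>, which bounds
  \<open>\<rho> \<xi>'\<close> from below. Letting t shrink with \<open>\<zeta>\<close> fixed yields
  continuity.\<close>

lemma convex_risk_measure_dist_le:
  assumes \<rho>: "convex_risk_measure M p \<rho>" and p: "0 \<le> p"
    and Lp: "\<xi> \<in> Lp M p" "\<xi>' \<in> Lp M p" "\<zeta> \<in> Lp M p"
    and t: "0 < t" "t \<le> 1" and AE: "AE \<omega> in M. \<bar>\<xi>' \<omega> - \<xi> \<omega>\<bar> \<le> t * \<zeta> \<omega>"
  shows "\<bar>\<rho> \<xi>' - \<rho> \<xi>\<bar> \<le> t * (\<rho> (\<lambda>\<omega>. \<xi> \<omega> + \<zeta> \<omega>) - \<rho> \<xi>)"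
proof -
  have mono: "\<rho> \<alpha> \<le> \<rho> \<beta>" if "\<alpha> \<in> Lp M p" "\<beta> \<in> Lp M p" "AE \<omega> in M. \<alpha> \<omega> \<le> \<beta> \<omega>" for \<alpha> \<beta>
    using \<rho> that by (auto simp: convex_risk_measure_def)
  have conv: "\<rho> (\<lambda>\<omega>. s * \<alpha> \<omega> + (1 - s) * \<beta> \<omega>) \<le> s * \<rho> \<alpha> + (1 - s) * \<rho> \<beta>"
    if "\<alpha> \<in> Lp M p" "\<beta> \<in> Lp M p" "0 \<le> s" "s \<le> 1" for \<alpha> \<beta> s
    using \<rho> that by (auto simp: convex_risk_measure_def)
  define \<beta> where "\<beta> = (\<lambda>\<omega>. \<xi> \<omega> + \<zeta> \<omega>)"
  have \<beta>: "\<beta> \<in> Lp M p" unfolding \<beta>_def using p Lp by (intro Lp_add)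
  have "\<rho> \<xi>' \<le> \<rho> (\<lambda>\<omega>. t * \<beta> \<omega> + (1 - t) * \<xi> \<omega>)"
    using AE by (intro mono Lp_add Lp_cmult \<beta> Lp p) (auto simp: \<beta>_def algebra_simps elim!: eventually_mono)
  also have "\<dots> \<le> t * \<rho> \<beta> + (1 - t) * \<rho> \<xi>" using t by (intro conv \<beta> Lp) auto
  finally have up: "\<rho> \<xi>' \<le> t * \<rho> \<beta> + (1 - t) * \<rho> \<xi>" .
  \<comment> \<open>The weight solves \<open>1 - s = s * t\<close>: dividing
    \<open>(1 + t) * \<xi> \<le> \<xi>' + t * (\<xi> + \<zeta>)\<close> by \<open>1 + t\<close>
    leaves a convex combination on the right.\<close>
  define s where "s = 1 / (1 + t)"
  have s: "0 \<le> s" "s \<le> 1" "1 - s = s * t" "(1 + t) * s = 1" using t by (auto simp: s_def field_simps)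
  have le: "\<xi> \<omega> \<le> s * \<xi>' \<omega> + (1 - s) * \<beta> \<omega>" if "\<bar>\<xi>' \<omega> - \<xi> \<omega>\<bar> \<le> t * \<zeta> \<omega>" for \<omega>
  proof -
    have "\<xi> \<omega> * (1 + t) \<le> \<xi>' \<omega> + t * \<beta> \<omega>" using that by (simp add: \<beta>_def algebra_simps)
    then have "s * (\<xi> \<omega> * (1 + t)) \<le> s * (\<xi>' \<omega> + t * \<beta> \<omega>)" using s by (intro mult_left_mono) auto
    moreover have "s * (\<xi> \<omega> * (1 + t)) = \<xi> \<omega>" using s(4) by (metis mult.assoc mult.commute mult.right_neutral)
    moreover have "(1 - s) * \<beta> \<omega> = s * (t * \<beta> \<omega>)" using s(3) by (simp only: mult.assoc)
    ultimately show ?thesis by (simp only: distrib_left)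
  qed
  have "\<rho> \<xi> \<le> \<rho> (\<lambda>\<omega>. s * \<xi>' \<omega> + (1 - s) * \<beta> \<omega>)"
    using AE by (intro mono Lp_add Lp_cmult \<beta> Lp p) (auto intro: le elim!: eventually_mono)
  also have "\<dots> \<le> s * \<rho> \<xi>' + (1 - s) * \<rho> \<beta>" using s by (intro conv \<beta> Lp) auto
  finally have "(1 + t) * \<rho> \<xi> \<le> (1 + t) * (s * (\<rho> \<xi>' + t * \<rho> \<beta>))"
    using t s by (intro mult_left_mono) (auto simp: algebra_simps)
  also have "\<dots> = \<rho> \<xi>' + t * \<rho> \<beta>" using s(4) by (metis mult.assoc mult.left_neutral)
  finally show ?thesis using up by (simp add: \<beta>_def[symmetric] algebra_simps abs_le_iff)
qed

text \<open>The majorant \<open>\<zeta>\<close> with \<open>\<bar>\<xi>s (r k) - \<xi>\<bar> \<le> \<zeta> / (k + 1)\<close> is the \<open>\<ell>\<^sup>p\<close>-norm over \<open>k\<close> of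
  \<open>(k + 1) (\<xi>s (r k) - \<xi>)\<close> for a sequence \<open>r\<close> along which the distances decrease geometrically.\<close>

lemma convex_risk_measure_tendsto:
  assumes \<rho>: "convex_risk_measure M p \<rho>" and p: "1 \<le> p"
    and Lp: "\<And>n. \<xi>s n \<in> Lp M p" "\<xi> \<in> Lp M p"
    and lim: "(\<lambda>n. \<integral>\<omega>. \<bar>\<xi>s n \<omega> - \<xi> \<omega>\<bar> powr p \<partial>M) \<longlonglongrightarrow> 0"
  shows "(\<lambda>n. \<rho> (\<xi>s n)) \<longlonglongrightarrow> \<rho> \<xi>"
proof (rule ccontr)
  \<comment> \<open>A common majorant can in general be found only along quickly converging terms,
    so convergence of the whole sequence is reached by contradiction: such terms are selected among
    the indices that violate it.\<close>
  assume "\<not> (\<lambda>n. \<rho> (\<xi>s n)) \<longlonglongrightarrow> \<rho> \<xi>"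
  then obtain e where e: "0 < e" "\<exists>\<^sub>F n in sequentially. e \<le> \<bar>\<rho> (\<xi>s n) - \<rho> \<xi>\<bar>"
    unfolding tendsto_iff by (force simp: frequently_def not_le dist_real_def)
  note [measurable] = LpD(1)[OF Lp(1)] LpD(1)[OF Lp(2)]
  define I where "I n = (\<integral>\<omega>. \<bar>\<xi>s n \<omega> - \<xi> \<omega>\<bar> powr p \<partial>M)" for n
  have int: "integrable M (\<lambda>\<omega>. \<bar>\<xi>s n \<omega> - \<xi> \<omega>\<bar> powr p)" for n
    using Lp p by (intro LpD(2) Lp_diff) auto
  \<comment> \<open>The divisor cancels the factor \<open>(real k + 1) powr p\<close> in
    \<open>f k\<close> below and leaves integrals of at most \<open>(1/2) ^ k\<close>, which are
    summable.\<close>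
  define \<delta> where "\<delta> k = (1/2) ^ k / (real k + 1) powr p" for k
  have "\<exists>n. e \<le> \<bar>\<rho> (\<xi>s n) - \<rho> \<xi>\<bar> \<and> I n < \<delta> k" for k
  proof -
    have "\<forall>\<^sub>F n in sequentially. I n < \<delta> k"
      unfolding I_def by (rule order_tendstoD(2)[OF lim]) (simp add: \<delta>_def)
    from frequently_ex[OF frequently_eventually_frequently[OF e(2) this]] show ?thesis .
  qed
  then obtain r where r: "\<And>k. e \<le> \<bar>\<rho> (\<xi>s (r k)) - \<rho> \<xi>\<bar>" "\<And>k. I (r k) < \<delta> k" by metis
  define f where "f k \<omega> = ((real k + 1) * \<bar>\<xi>s (r k) \<omega> - \<xi> \<omega>\<bar>) powr p" for k \<omega>
  have f_eq: "f k \<omega> = (real k + 1) powr p * \<bar>\<xi>s (r k) \<omega> - \<xi> \<omega>\<bar> powr p" for k \<omega>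
    by (simp add: f_def powr_mult)
  have f0: "0 \<le> f k \<omega>" for k \<omega> by (simp add: f_def)
  have fint: "integrable M (f k)" for k unfolding f_eq using int by auto
  have fI: "(\<integral>\<omega>. f k \<omega> \<partial>M) \<le> (1/2) ^ k" for k
  proof -
    have "(\<integral>\<omega>. f k \<omega> \<partial>M) = (real k + 1) powr p * I (r k)" unfolding f_eq I_def by simp
    also have "\<dots> \<le> (real k + 1) powr p * \<delta> k" using r(2)[of k] by (intro mult_left_mono) auto
    also have "\<dots> = (1/2) ^ k" by (simp add: \<delta>_def)
    finally show ?thesis .
  qed
  have f_nn: "(\<integral>\<^sup>+\<omega>. ennreal (f k \<omega>) \<partial>M) \<le> ennreal ((1/2) ^ k)" for k
    using fI[of k] by (subst nn_integral_eq_integral[OF fint]) (auto simp: f0 intro!: ennreal_leI)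
  have [measurable]: "f k \<in> borel_measurable M" for k using fint by auto
  have "(\<integral>\<^sup>+\<omega>. (\<Sum>k. ennreal (f k \<omega>)) \<partial>M) = (\<Sum>k. \<integral>\<^sup>+\<omega>. ennreal (f k \<omega>) \<partial>M)"
    by (rule nn_integral_suminf) simp
  also have "\<dots> \<le> (\<Sum>k. ennreal ((1/2) ^ k))" by (intro suminf_le f_nn) auto
  also have "\<dots> < \<infinity>" by (subst suminf_ennreal2) (auto intro: summable_geometric)
  finally have "AE \<omega> in M. (\<Sum>k. ennreal (f k \<omega>)) \<noteq> \<infinity>"
    by (intro nn_integral_PInf_AE) auto
  then have sum_AE: "AE \<omega> in M. summable (\<lambda>k. f k \<omega>)"
    by eventually_elim (auto intro!: summable_suminf_not_top f0 simp: infinity_ennreal_def)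
  have sum_I: "summable (\<lambda>k. \<integral>\<omega>. norm (f k \<omega>) \<partial>M)"
    by (rule summable_comparison_test'[OF summable_geometric[of "1/2"], of 0])
      (use fI f0 in \<open>auto simp: integral_nonneg_AE\<close>)
  have Sint: "integrable M (\<lambda>\<omega>. \<Sum>k. f k \<omega>)"
    using fint sum_AE sum_I f0 by (intro integrable_suminf) auto
  have S0: "AE \<omega> in M. 0 \<le> (\<Sum>k. f k \<omega>)"
    using sum_AE by eventually_elim (intro suminf_nonneg f0)
  \<comment> \<open>On the null set where the series diverges the infinite sum is a default value;
    the estimates for \<open>\<zeta>\<close> are therefore almost sure ones.\<close>
  define \<zeta> where "\<zeta> \<omega> = (\<Sum>k. f k \<omega>) powr (1 / p)" for \<omega>
  have "integrable M (\<lambda>\<omega>. \<bar>\<zeta> \<omega>\<bar> powr p)"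
  proof (rule integrable_cong_AE_imp[OF Sint])
    show "AE \<omega> in M. (\<Sum>k. f k \<omega>) = \<bar>\<zeta> \<omega>\<bar> powr p"
      using S0 by eventually_elim (use p in \<open>simp add: \<zeta>_def powr_powr\<close>)
  qed (simp add: \<zeta>_def[abs_def])
  then have \<zeta>: "\<zeta> \<in> Lp M p" by (simp add: Lp_def \<zeta>_def[abs_def])
  have dom: "AE \<omega> in M. \<bar>\<xi>s (r k) \<omega> - \<xi> \<omega>\<bar> \<le> 1 / (real k + 1) * \<zeta> \<omega>" for k
    using sum_AE
  proof eventually_elim
    case (elim \<omega>)
    have "f k \<omega> = sum (\<lambda>k. f k \<omega>) {k}" by simp
    also have "\<dots> \<le> (\<Sum>k. f k \<omega>)" using elim f0 by (intro sum_le_suminf) auto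
    finally have "f k \<omega> powr (1 / p) \<le> \<zeta> \<omega>" unfolding \<zeta>_def using f0 p by (intro powr_mono2) auto
    moreover have "f k \<omega> powr (1 / p) = (real k + 1) * \<bar>\<xi>s (r k) \<omega> - \<xi> \<omega>\<bar>"
      using p by (simp add: f_def powr_powr)
    ultimately show ?case by (simp add: field_simps)
  qed
  \<comment> \<open>\<open>\<zeta>\<close> does not depend on k, so the right-hand side tends to 0
    while e stays fixed.\<close>
  have bound: "e \<le> 1 / (real k + 1) * (\<rho> (\<lambda>\<omega>. \<xi> \<omega> + \<zeta> \<omega>) - \<rho> \<xi>)" for k
    using convex_risk_measure_dist_le[OF \<rho> _ Lp(2) Lp(1) \<zeta> _ _ dom[of k]] p r(1)[of k] by simp
  have "(\<lambda>k. 1 / (real k + 1) * (\<rho> (\<lambda>\<omega>. \<xi> \<omega> + \<zeta> \<omega>) - \<rho> \<xi>)) \<longlonglongrightarrow> 0 * (\<rho> (\<lambda>\<omega>. \<xi> \<omega> + \<zeta> \<omega>) - \<rho> \<xi>)"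
    using LIMSEQ_inverse_real_of_nat by (intro tendsto_mult tendsto_const) (simp add: inverse_eq_divide add.commute)
  then have "e \<le> 0" using bound by (intro LIMSEQ_le_const) auto
  then show False using e(1) by simp
qed

section \<open>Quantile functions\<close>

lemma
  assumes "real_distribution \<mu>"
  shows quantile_le_iff: "0 < u \<Longrightarrow> u < 1 \<Longrightarrow> quantile \<mu> u \<le> x \<longleftrightarrow> u \<le> cdf \<mu> x"
    and mono_on_quantile: "mono_on {0<..<1} (quantile \<mu>)"
proof -
  interpret cdf_distribution \<mu> using assms by (simp add: cdf_distribution_def)
  show "0 < u \<Longrightarrow> u < 1 \<Longrightarrow> quantile \<mu> u \<le> x \<longleftrightarrow> u \<le> cdf \<mu> x"
    unfolding quantile_def by (rule pseudoinverse[symmetric])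
  show "mono_on {0<..<1} (quantile \<mu>)"
    using mono_I unfolding quantile_def[abs_def] .
qed

text \<open>Monotonicity holds piecewise: below and at 0 the defining infimum is over all reals and
  above 1 over the empty set, a constant in either case. The point 1 may be of either kind and forms
  a piece of its own.\<close>

lemma borel_measurable_quantile [measurable]:
  assumes "real_distribution \<mu>"
  shows "quantile \<mu> \<in> borel_measurable borel"
proof (rule borel_measurable_piecewise_mono[of "{{..0}, {0<..<1}, {1}, {1<..}}"])
  interpret real_distribution \<mu> by fact
  have "{t. u \<le> cdf \<mu> t} = UNIV" if "u \<le> 0" for u
    using cdf_nonneg that by (auto intro: order_trans)
  moreover have "{t. u \<le> cdf \<mu> t} = {}" if "1 < u" for u
    using cdf_bounded_prob that by (auto simp: not_le intro: le_less_trans)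
  ultimately have "mono_on {..0} (quantile \<mu>)" "mono_on {1<..} (quantile \<mu>)"
    by (auto simp: mono_on_def quantile_def)
  then show "mono_on c (quantile \<mu>)" if "c \<in> {{..0}, {0<..<1}, {1}, {1<..}}" for c
    using that mono_on_quantile[OF assms] by (auto simp: mono_on_def)
qed auto

lemma AE_uniform_avoids_countable:
  assumes U: "U \<in> borel_measurable M" "distr M borel U = uniform_measure lborel {0..1}"
    and "countable (D :: real set)"
  shows "AE \<omega> in M. 0 < U \<omega> \<and> U \<omega> < 1 \<and> U \<omega> \<notin> D"
proof -
  let ?D = "insert 0 (insert 1 D) :: real set"
  have "countable ?D" using assms by simp
  then have "?D \<in> null_sets lborel" by (rule countable_imp_null_set_lborel)
  then have "AE u in lborel. u \<notin> ?D" by (rule AE_not_in)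
  then have "AE u in uniform_measure lborel {0..1}. 0 < u \<and> u < 1 \<and> u \<notin> D"
    by (intro AE_uniform_measureI) (simp, elim eventually_mono, auto)
  then have "AE u in distr M borel U. 0 < u \<and> u < 1 \<and> u \<notin> D" unfolding U(2) .
  then show ?thesis by (rule AE_distrD[OF U(1)])
qed

lemma distr_quantile_uniform:
  assumes \<mu>: "real_distribution \<mu>"
    and U: "U \<in> borel_measurable M" "distr M borel U = uniform_measure lborel {0..1}"
  shows "distr M borel (\<lambda>\<omega>. quantile \<mu> (U \<omega>)) = \<mu>"
proof -
  interpret cdf_distribution \<mu> using \<mu> by (simp add: cdf_distribution_def)
  note [measurable] = borel_measurable_quantile[OF \<mu>] U(1)
  have "distr M borel (\<lambda>\<omega>. quantile \<mu> (U \<omega>)) = distr (uniform_measure lborel {0..1}) borel (quantile \<mu>)"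
    unfolding U(2)[symmetric] by (subst distr_distr) (auto simp: comp_def)
  \<comment> \<open>The inverse transform is available on the open unit interval, the uniform
    measure sits on the closed one; they differ by two null points.\<close>
  also have "\<dots> = distr (restrict_space lborel {0<..<1}) borel (quantile \<mu>)"
  proof (rule measure_eqI)
    fix A assume "A \<in> sets (distr (uniform_measure lborel {0..1}) borel (quantile \<mu>))"
    then have [measurable]: "A \<in> sets borel" by simp
    have Q: "quantile \<mu> -` A \<in> sets borel"
      using measurable_sets_borel[OF borel_measurable_quantile[OF \<mu>]] by auto
    have "AE u in lborel. u \<in> {0..1} \<inter> quantile \<mu> -` A \<longleftrightarrow> u \<in> {0<..<1} \<inter> quantile \<mu> -` A"
      using AE_lborel_singleton[of 0] AE_lborel_singleton[of 1] by eventually_elim auto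
    then have "emeasure lborel ({0..1} \<inter> quantile \<mu> -` A) = emeasure lborel ({0<..<1} \<inter> quantile \<mu> -` A)"
      using Q by (intro emeasure_eq_AE) auto
    then show "emeasure (distr (uniform_measure lborel {0..1}) borel (quantile \<mu>)) A =
        emeasure (distr (restrict_space lborel {0<..<1}) borel (quantile \<mu>)) A"
      using Q by (simp add: emeasure_distr measurable_restrict_space1 emeasure_restrict_space
          space_restrict_space Int_commute divide_ennreal_def)
  qed simp
  also have "\<dots> = \<mu>" using distr_I_eq_M unfolding quantile_def[abs_def] .
  finally show ?thesis .
qed

lemma quantile_tendsto:
  assumes \<mu>: "\<And>n. real_distribution (\<mu>s n)" "real_distribution \<mu>" "weak_conv_m \<mu>s \<mu>"
    and u: "0 < u" "u < 1" "isCont (quantile \<mu>) u"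
  shows "(\<lambda>n. quantile (\<mu>s n) u) \<longlonglongrightarrow> quantile \<mu> u"
proof -
  interpret real_distribution \<mu> by fact
  \<comment> \<open>Only countably many points carry mass, so every interval contains a continuity
    point of \<open>cdf \<mu>\<close>, where weak convergence gives convergence of the distribution
    functions.\<close>
  have between: "\<exists>x. a < x \<and> x < b \<and> (\<lambda>n. cdf (\<mu>s n) x) \<longlonglongrightarrow> cdf \<mu> x" if "a < b" for a b
  proof -
    have "\<exists>x\<in>{a<..<b}. measure \<mu> {x} = 0"
      using open_minus_countable[OF countable_support, of "{a<..<b}"] that by auto
    then show ?thesis
      using \<mu>(3) isCont_cdf by (auto simp: weak_conv_m_def weak_conv_def)
  qed
  show ?thesis
  proof (rule order_tendstoI)
    fix a assume "a < quantile \<mu> u"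
    then obtain x where x: "a < x" "x < quantile \<mu> u" "(\<lambda>n. cdf (\<mu>s n) x) \<longlonglongrightarrow> cdf \<mu> x"
      using between by blast
    then have "cdf \<mu> x < u" using quantile_le_iff[OF \<mu>(2) u(1,2), of x] by auto
    with x(3) have "\<forall>\<^sub>F n in sequentially. cdf (\<mu>s n) x < u" by (rule order_tendstoD)
    then show "\<forall>\<^sub>F n in sequentially. a < quantile (\<mu>s n) u"
    proof eventually_elim
      case (elim n)
      then have "\<not> quantile (\<mu>s n) u \<le> x" by (simp add: quantile_le_iff[OF \<mu>(1) u(1,2)])
      with x(1) show ?case by simp
    qed
  next
    fix b assume b: "quantile \<mu> u < b"
    \<comment> \<open>At u itself one would get only \<open>u \<le> cdf \<mu> x\<close>, which need
      not pass to \<open>\<mu>s n\<close>. Continuity of the quantile provides v > u whose quantile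
      is still below b, and this makes the inequality strict.\<close>
    have "(quantile \<mu> \<longlongrightarrow> quantile \<mu> u) (at_right u)"
      using u(3) by (simp add: isCont_def filterlim_at_split)
    from order_tendstoD(2)[OF this b] have "\<forall>\<^sub>F v in at_right u. v \<in> {u<..<1} \<and> quantile \<mu> v < b"
      by (intro eventually_conj eventually_at_right_real u)
    from eventually_happens'[OF _ this] obtain v where v: "u < v" "v < 1" "quantile \<mu> v < b"
      by auto
    obtain x where x: "quantile \<mu> v < x" "x < b" "(\<lambda>n. cdf (\<mu>s n) x) \<longlonglongrightarrow> cdf \<mu> x"
      using between[OF v(3)] by blast
    have "u < cdf \<mu> x" using quantile_le_iff[OF \<mu>(2), of v x] v u x by auto
    with x(3) have "\<forall>\<^sub>F n in sequentially. u < cdf (\<mu>s n) x" by (rule order_tendstoD)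
    then show "\<forall>\<^sub>F n in sequentially. quantile (\<mu>s n) u < b"
    proof eventually_elim
      case (elim n)
      then have "quantile (\<mu>s n) u \<le> x" by (simp add: quantile_le_iff[OF \<mu>(1) u(1,2)])
      with x(2) show ?case by simp
    qed
  qed
qed

text \<open>The exceptional levels are discontinuities of a monotone function, hence countably many,
  and a uniform variable avoids them.\<close>

lemma AE_quantile_tendsto:
  assumes \<mu>: "\<And>n. real_distribution (\<mu>s n)" "real_distribution \<mu>" "weak_conv_m \<mu>s \<mu>"
    and U: "U \<in> borel_measurable M" "distr M borel U = uniform_measure lborel {0..1}"
  shows "AE \<omega> in M. (\<lambda>n. quantile (\<mu>s n) (U \<omega>)) \<longlonglongrightarrow> quantile \<mu> (U \<omega>)"
proof -
  have "countable {u \<in> {0<..<1}. \<not> isCont (quantile \<mu>) u}"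
    using mono_on_quantile[OF \<mu>(2)] by (intro mono_on_ctble_discont_open) auto
  from AE_uniform_avoids_countable[OF U this] show ?thesis
    by eventually_elim (auto intro: quantile_tendsto[OF \<mu>])
qed

lemma quantile_mono:
  assumes \<mu>: "real_distribution \<mu>" "real_distribution \<nu>" and le: "\<And>x. cdf \<nu> x \<le> cdf \<mu> x"
    and u: "0 < u" "u < 1"
  shows "quantile \<mu> u \<le> quantile \<nu> u"
proof -
  have "u \<le> cdf \<nu> (quantile \<nu> u)" using quantile_le_iff[OF \<mu>(2) u, of "quantile \<nu> u"] by simp
  also have "\<dots> \<le> cdf \<mu> (quantile \<nu> u)" by (rule le)
  finally show ?thesis by (simp add: quantile_le_iff[OF \<mu>(1) u])
qed

section \<open>Transport of random variables from Q to M by quantiles\<close>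

context
  fixes Q :: "'b measure" and p :: real and M :: "'w measure" and U :: "'w \<Rightarrow> real"
  assumes Q: "prob_space Q"
    and U: "U \<in> borel_measurable M" "distr M borel U = uniform_measure lborel {0..1}"
begin

lemma
  assumes "\<phi> \<in> Lp Q p"
  shows quantile_in_Lp: "(\<lambda>\<omega>. quantile (distr Q borel \<phi>) (U \<omega>)) \<in> Lp M p"
    and integral_quantile_powr:
      "(\<integral>\<omega>. \<bar>quantile (distr Q borel \<phi>) (U \<omega>)\<bar> powr p \<partial>M) = (\<integral>x. \<bar>\<phi> x\<bar> powr p \<partial>Q)"
proof -
  have m[measurable]: "\<phi> \<in> borel_measurable Q" using assms by (simp add: Lp_def)
  let ?\<mu> = "distr Q borel \<phi>"
  have \<mu>: "real_distribution ?\<mu>" by (rule prob_space.real_distribution_distr[OF Q m])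
  note [measurable] = borel_measurable_quantile[OF \<mu>] U(1)
  have "integrable ?\<mu> (\<lambda>t. \<bar>t\<bar> powr p)" using assms by (simp add: integrable_distr_eq Lp_def)
  then have "integrable (distr M borel (\<lambda>\<omega>. quantile ?\<mu> (U \<omega>))) (\<lambda>t. \<bar>t\<bar> powr p)"
    unfolding distr_quantile_uniform[OF \<mu> U] .
  then show "(\<lambda>\<omega>. quantile ?\<mu> (U \<omega>)) \<in> Lp M p" by (simp add: integrable_distr_eq Lp_def)
  have "(\<integral>\<omega>. \<bar>quantile ?\<mu> (U \<omega>)\<bar> powr p \<partial>M) =
      (\<integral>t. \<bar>t\<bar> powr p \<partial>distr M borel (\<lambda>\<omega>. quantile ?\<mu> (U \<omega>)))"
    by (subst integral_distr) auto
  also have "\<dots> = (\<integral>x. \<bar>\<phi> x\<bar> powr p \<partial>Q)"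
    unfolding distr_quantile_uniform[OF \<mu> U] by (subst integral_distr) auto
  finally show "(\<integral>\<omega>. \<bar>quantile ?\<mu> (U \<omega>)\<bar> powr p \<partial>M) = (\<integral>x. \<bar>\<phi> x\<bar> powr p \<partial>Q)" .
qed

text \<open>\<open>\<phi>\<close> and \<open>\<psi>\<close> are compared on Q, their quantiles on M,
  so the order travels through the laws: \<open>\<phi> \<le> \<psi>\<close> reverses the order of
  the distribution functions, which in turn orders the quantiles at every level in the open unit
  interval.\<close>

lemma AE_quantile_mono:
  assumes m: "\<phi> \<in> borel_measurable Q" "\<psi> \<in> borel_measurable Q" and le: "AE x in Q. \<phi> x \<le> \<psi> x"
  shows "AE \<omega> in M. quantile (distr Q borel \<phi>) (U \<omega>) \<le> quantile (distr Q borel \<psi>) (U \<omega>)"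
proof -
  interpret prob_space Q by fact
  have "cdf (distr Q borel \<psi>) x \<le> cdf (distr Q borel \<phi>) x" for x
    unfolding cdf_def using m
    by (simp add: measure_distr) (rule finite_measure_mono_AE, use le in \<open>auto elim: eventually_mono\<close>)
  then have "quantile (distr Q borel \<phi>) u \<le> quantile (distr Q borel \<psi>) u" if "0 < u" "u < 1" for u
    using m that by (intro quantile_mono real_distribution_distr)
  moreover have "AE \<omega> in M. 0 < U \<omega> \<and> U \<omega> < 1 \<and> U \<omega> \<notin> {}"
    by (rule AE_uniform_avoids_countable[OF U]) simp
  ultimately show ?thesis by (elim eventually_mono) simp
qed

end

section \<open>Uniform random variables on nonatomic spaces\<close>

context prob_space
begin

text \<open>Nonatomicity splits a set into two parts of positive measure, and one of them has at
  most half of the measure. Iterated halving gets below any bound.\<close>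

lemma nonatomic_small_subset:
  assumes "nonatomic M" and A: "A \<in> sets M" "0 < measure M A" and e: "0 < e"
  obtains B where "B \<in> sets M" "B \<subseteq> A" "0 < measure M B" "measure M B < e"
proof -
  have half: "\<exists>C\<in>sets M. C \<subseteq> B \<and> 0 < measure M C \<and> measure M C \<le> measure M B / 2"
    if B: "B \<in> sets M" "0 < measure M B" for B
  proof -
    obtain C where C: "C \<in> sets M" "C \<subseteq> B" "0 < measure M C" "measure M C < measure M B"
      using \<open>nonatomic M\<close> B unfolding nonatomic_def by blast
    have "measure M (B - C) = measure M B - measure M C" using B C by (intro finite_measure_Diff)
    then have "\<exists>D\<in>{C, B - C}. 0 < measure M D \<and> measure M D \<le> measure M B / 2" using C by auto
    then show ?thesis using B C by blast
  qed
  have *: "\<exists>B\<in>sets M. B \<subseteq> A \<and> 0 < measure M B \<and> measure M B \<le> measure M A / 2 ^ n" for n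
  proof (induction n)
    case 0 then show ?case using A by auto
  next
    case (Suc n)
    then obtain B where B: "B \<in> sets M" "B \<subseteq> A" "0 < measure M B" "measure M B \<le> measure M A / 2 ^ n"
      by blast
    obtain C where "C \<in> sets M" "C \<subseteq> B" "0 < measure M C" "measure M C \<le> measure M B / 2"
      using half[OF B(1,3)] by blast
    moreover have "measure M C \<le> measure M A / 2 ^ n / 2"
      by (rule order_trans[OF calculation(4) divide_right_mono[OF B(4)]]) simp
    ultimately show ?case using B(2) by (intro bexI[of _ C]) (auto simp: mult.commute)
  qed
  obtain n where "measure M A / e < 2 ^ n" using real_arch_pow[of 2] by auto
  then have "measure M A / 2 ^ n < e" using e by (simp add: field_simps)
  with *[of n] that show thesis by (meson le_less_trans)
qed

text \<open>Exhaustion: each step adds a set that has at least half of the largest measure possible.\<close>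

lemma nonatomic_subset_of_measure:
  assumes na: "nonatomic M" and A: "A \<in> sets M" and \<alpha>: "0 \<le> \<alpha>" "\<alpha> \<le> measure M A"
  obtains B where "B \<in> sets M" "B \<subseteq> A" "measure M B = \<alpha>"
proof -
  define P where "P B \<longleftrightarrow> B \<in> sets M \<and> B \<subseteq> A \<and> measure M B \<le> \<alpha>" for B
  define T where "T B D \<longleftrightarrow> D \<in> sets M \<and> D \<subseteq> A - B \<and> measure M B + measure M D \<le> \<alpha>" for B D
  have step: "\<exists>B'. P B' \<and> B \<subseteq> B' \<and> (\<forall>D. T B D \<longrightarrow> measure M D \<le> 2 * (measure M B' - measure M B))"
    if B: "P B" for B
  proof -
    define s where "s = Sup (measure M ` {D. T B D})"
    have T0: "T B {}" using B by (auto simp: T_def P_def)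
    have bdd: "bdd_above (measure M ` {D. T B D})" by (rule bdd_aboveI2[of _ _ 1]) simp
    have le: "measure M D \<le> s" if "T B D" for D
      unfolding s_def using that by (intro cSUP_upper bdd) auto
    \<comment> \<open>The supremum need not be attained, so half of it is aimed at; if it is 0, the
      empty set serves.\<close>
    obtain D0 where D0: "T B D0" "s \<le> 2 * measure M D0"
    proof (cases "s \<le> 0")
      case True then show thesis using that[OF T0] by simp
    next
      case False
      then have "s / 2 < Sup (measure M ` {D. T B D})" by (simp add: s_def[symmetric])
      then obtain D where "T B D" "s / 2 < measure M D"
        using less_cSup_iff[OF _ bdd, of "s / 2"] T0 by auto
      then show thesis using that[of D] by simp
    qed
    have "measure M (B \<union> D0) = measure M B + measure M D0"
      using B D0 by (intro finite_measure_Union) (auto simp: P_def T_def)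
    then have "P (B \<union> D0)" "measure M D \<le> 2 * (measure M (B \<union> D0) - measure M B)" if "T B D" for D
      using B D0 le[OF that] by (auto simp: P_def T_def)
    then show ?thesis using T0 by (intro exI[of _ "B \<union> D0"]) auto
  qed
  have "\<exists>Bs. \<forall>n. P (Bs n) \<and> (Bs n \<subseteq> Bs (Suc n) \<and>
      (\<forall>D. T (Bs n) D \<longrightarrow> measure M D \<le> 2 * (measure M (Bs (Suc n)) - measure M (Bs n))))"
  proof (rule dependent_nat_choice)
    show "\<exists>B. P B" using \<alpha> by (auto simp: P_def intro!: exI[of _ "{}"])
  qed (use step in blast)
  then obtain Bs where Bs: "\<And>n. P (Bs n)" "\<And>n. Bs n \<subseteq> Bs (Suc n)"
    "\<And>n D. T (Bs n) D \<Longrightarrow> measure M D \<le> 2 * (measure M (Bs (Suc n)) - measure M (Bs n))" by blast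
  define B where "B = (\<Union>n. Bs n)"
  have BsM: "Bs n \<in> sets M" for n using Bs(1) by (simp add: P_def)
  then have B: "B \<in> sets M" "B \<subseteq> A" using Bs(1) by (auto simp: B_def P_def)
  have lim: "(\<lambda>n. measure M (Bs n)) \<longlonglongrightarrow> measure M B"
    unfolding B_def using BsM Bs(2) by (intro finite_Lim_measure_incseq) (auto intro: incseq_SucI)
  have le: "measure M B \<le> \<alpha>" using Bs(1) by (intro LIMSEQ_le_const2[OF lim]) (auto simp: P_def)
  have "measure M B = \<alpha>"
  proof (rule ccontr)
    \<comment> \<open>A deficit leaves room for a small set D of positive measure outside B. As D
      competes at every step, each increment is at least half its measure, yet the increments of a
      convergent sequence tend to 0.\<close>
    assume "measure M B \<noteq> \<alpha>"
    with le have lt: "measure M B < \<alpha>" by simp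
    have "0 < measure M (A - B)" using A B lt \<alpha> by (simp add: finite_measure_Diff)
    then obtain D where D: "D \<in> sets M" "D \<subseteq> A - B" "0 < measure M D" "measure M D < \<alpha> - measure M B"
      using nonatomic_small_subset[OF na, of "A - B" "\<alpha> - measure M B"] A B lt by auto
    have "T (Bs n) D" for n
    proof -
      have "measure M (Bs n) \<le> measure M B" using B by (intro finite_measure_mono) (auto simp: B_def)
      then show ?thesis using D by (auto simp: T_def B_def)
    qed
    then have "measure M D \<le> 2 * (measure M (Bs (Suc n)) - measure M (Bs n))" for n using Bs(3) by blast
    moreover have "(\<lambda>n. 2 * (measure M (Bs (Suc n)) - measure M (Bs n))) \<longlonglongrightarrow> 2 * (measure M B - measure M B)"
      by (intro tendsto_intros lim LIMSEQ_Suc)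
    ultimately have "measure M D \<le> 0" by (intro LIMSEQ_le_const) auto
    with D show False by simp
  qed
  with B that show thesis by blast
qed

end

text \<open>If \<open>half\<close> halves measures, stage n is a decreasing chain of sets of
  probability 1 - k / 2 ^ n, empty beyond 2 ^ n, meant as superlevel sets of a uniform variable.
  Refinement copies the old sets to even indices, so that a set depends only on the dyadic number k
  / 2 ^ n, and puts at odd indices the smaller neighbour enlarged by half of the gap.\<close>

primrec dyadic_split :: "('w set \<Rightarrow> 'w set) \<Rightarrow> 'w set \<Rightarrow> nat \<Rightarrow> nat \<Rightarrow> 'w set" where
  "dyadic_split half S 0 k = (if k = 0 then S else {})"
| "dyadic_split half S (Suc n) k =
     (let A = dyadic_split half S n (k div 2); B = dyadic_split half S n (Suc (k div 2))
      in if even k then A else B \<union> half (A - B))"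

lemma (in prob_space) dyadic_split:
  assumes half: "\<And>A. A \<in> sets M \<Longrightarrow> half A \<in> sets M \<and> half A \<subseteq> A \<and> measure M (half A) = measure M A / 2"
  defines "C \<equiv> dyadic_split half (space M)"
  shows dyadic_split_sets: "C n k \<in> sets M"
    and dyadic_split_Suc_subset: "C n (Suc k) \<subseteq> C n k"
    and measure_dyadic_split: "measure M (C n k) = max 0 (1 - real k / 2 ^ n)"
proof -
  have *: "\<forall>k. C n k \<in> sets M \<and> C n (Suc k) \<subseteq> C n k \<and> measure M (C n k) = max 0 (1 - real k / 2 ^ n)"
  proof (induction n)
    case 0
    then show ?case by (auto simp: C_def prob_space)
  next
    case (Suc n)
    have even: "C (Suc n) (2 * j) = C n j" for j by (simp add: C_def)
    have odd: "C (Suc n) (Suc (2 * j)) = C n (Suc j) \<union> half (C n j - C n (Suc j))" for j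
      by (simp add: C_def Let_def)
    have h: "half (C n j - C n (Suc j)) \<in> sets M" "half (C n j - C n (Suc j)) \<subseteq> C n j - C n (Suc j)"
      "measure M (half (C n j - C n (Suc j))) = (measure M (C n j) - measure M (C n (Suc j))) / 2" for j
      using half[of "C n j - C n (Suc j)"] Suc.IH by (auto simp: finite_measure_Diff)
    show ?case
    proof
      fix k
      show "C (Suc n) k \<in> sets M \<and> C (Suc n) (Suc k) \<subseteq> C (Suc n) k \<and>
        measure M (C (Suc n) k) = max 0 (1 - real k / 2 ^ Suc n)"
      proof (cases "even k")
        case True
        then obtain j where k: "k = 2 * j" by blast
        show ?thesis using Suc.IH h(2)[of j] by (auto simp: k even odd)
      next
        case False
        then obtain j where k: "k = Suc (2 * j)" using oddE by fastforce
        have "measure M (C (Suc n) k) = measure M (C n (Suc j)) + measure M (half (C n j - C n (Suc j)))"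
          unfolding k odd using h(1,2)[of j] Suc.IH by (intro finite_measure_Union) auto
        also have "\<dots> = (max 0 (1 - real j / 2 ^ n) + max 0 (1 - real (Suc j) / 2 ^ n)) / 2"
          unfolding h(3) using Suc.IH by (simp add: field_simps)
        also have "\<dots> = max 0 (1 - real k / 2 ^ Suc n)"
        proof -
          \<comment> \<open>Averaging neighbours commutes with the positive part only if the kink at
            N is not strictly between them, which holds because j and 2 ^ n are integers.\<close>
          have avg: "(max 0 (1 - x / N) + max 0 (1 - (x + 1) / N)) / 2 = max 0 (1 - (2 * x + 1) / (2 * N))"
            if "0 < N" "x + 1 \<le> N \<or> N \<le> x" for x N :: real
            using that by (auto simp: max_def field_simps)
          have "Suc j \<le> 2 ^ n \<or> 2 ^ n \<le> j" by linarith
          then have "real (Suc j) \<le> 2 ^ n \<or> 2 ^ n \<le> real j"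
            by (metis of_nat_le_iff of_nat_numeral of_nat_power)
          then show ?thesis using avg[of "2 ^ n" "real j"] by (simp add: k add.commute)
        qed
        finally have m: "measure M (C (Suc n) k) = max 0 (1 - real k / 2 ^ Suc n)" .
        have "C (Suc n) (Suc k) = C n (Suc j)" using even[of "Suc j"] by (simp add: k)
        then show ?thesis using m h(1)[of j] Suc.IH by (auto simp: k odd)
      qed
    qed
  qed
  show "C n k \<in> sets M" "C n (Suc k) \<subseteq> C n k" "measure M (C n k) = max 0 (1 - real k / 2 ^ n)"
    using * by auto
qed

text \<open>V is the supremum of the levels k / 2 ^ n whose set contains the point. Hence V > t
  holds exactly on the union of the sets of level above t, and squeezing t between neighbouring
  dyadic numbers gives the tail probabilities of the uniform law.\<close>

lemma (in prob_space) nonatomic_uniform_rv: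
  assumes na: "nonatomic M"
  shows "\<exists>U :: 'a \<Rightarrow> real. U \<in> borel_measurable M \<and> distr M borel U = uniform_measure lborel {0..1}"
proof -
  \<comment> \<open>The implication sits under the existential quantifier so that
    \<open>half\<close> can be chosen as a total function.\<close>
  have "\<exists>B. A \<in> sets M \<longrightarrow> B \<in> sets M \<and> B \<subseteq> A \<and> measure M B = measure M A / 2" for A
  proof (cases "A \<in> sets M")
    case True
    show ?thesis
      by (rule nonatomic_subset_of_measure[OF na True, of "measure M A / 2"]) auto
  qed auto
  then obtain half where half: "\<And>A. A \<in> sets M \<Longrightarrow> half A \<in> sets M \<and> half A \<subseteq> A \<and> measure M (half A) = measure M A / 2"
    by metis
  define C where "C = dyadic_split half (space M)"
  have sets[measurable]: "C n k \<in> sets M" for n k using dyadic_split_sets[OF half] by (simp add: C_def)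
  have meas: "measure M (C n k) = max 0 (1 - real k / 2 ^ n)" for n k
    using measure_dyadic_split[OF half] by (simp add: C_def)
  have anti: "C n l \<subseteq> C n k" if "k \<le> l" for n k l
  proof (rule lift_Suc_antimono_le[of "C n"])
    show "C n (Suc j) \<subseteq> C n j" for j using dyadic_split_Suc_subset[OF half] by (simp add: C_def)
  qed (rule that)
  have refine: "C (n + d) (2 ^ d * k) = C n k" for n d k
    by (induction d) (simp_all add: C_def mult.assoc)
  \<comment> \<open>\<open>refine\<close> moves both sets to the common stage \<open>m + n\<close>,
    where the chain is decreasing.\<close>
  have mono: "C m l \<subseteq> C n k" if "real k / 2 ^ n \<le> real l / 2 ^ m" for n k m l
  proof -
    have "real (2 ^ m * k) \<le> real (2 ^ n * l)" using that by (simp add: field_simps)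
    then have "2 ^ m * k \<le> 2 ^ n * l" by (simp only: of_nat_le_iff)
    then have "C (m + n) (2 ^ n * l) \<subseteq> C (n + m) (2 ^ m * k)"
      using anti by (simp add: add.commute)
    then show ?thesis by (simp only: refine)
  qed
  have top: "k \<le> 2 ^ n" if "\<omega> \<in> C n k" for \<omega> n k
  proof -
    have "C n k = {}" if "2 ^ n < k"
    proof -
      have "real 1 / 2 ^ 0 \<le> real k / 2 ^ n" using that by (simp add: le_divide_eq)
      from mono[OF this] show ?thesis by (simp add: C_def)
    qed
    then show ?thesis using that by (auto simp: not_less[symmetric])
  qed
  define V where "V \<omega> = Sup {real k / 2 ^ n | n k. \<omega> \<in> C n k}" for \<omega>
  define E where "E t = (\<Union>n. \<Union>k\<in>{k. t < real k / 2 ^ n}. C n k)" for t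
  have E: "{\<omega> \<in> space M. t < V \<omega>} = E t" for t
  proof -
    have "t < V \<omega> \<longleftrightarrow> (\<exists>n k. \<omega> \<in> C n k \<and> t < real k / 2 ^ n)" if \<omega>: "\<omega> \<in> space M" for \<omega>
      unfolding V_def
    proof (subst less_cSup_iff)
      have "\<omega> \<in> C 0 0" using \<omega> by (simp add: C_def)
      then show "{real k / 2 ^ n | n k. \<omega> \<in> C n k} \<noteq> {}" by blast
      have "real k \<le> 2 ^ n" if "\<omega> \<in> C n k" for n k
        using top[OF that] by (metis of_nat_le_iff of_nat_numeral of_nat_power)
      then show "bdd_above {real k / 2 ^ n | n k. \<omega> \<in> C n k}"
        by (intro bdd_aboveI[of _ 1]) auto
    qed auto
    then show ?thesis using sets.sets_into_space[OF sets] by (auto simp: E_def) blast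
  qed
  have Em[measurable]: "E t \<in> sets M" for t unfolding E_def by measurable
  have V[measurable]: "V \<in> borel_measurable M"
    by (rule borel_measurable_iff_greater[THEN iffD2]) (simp add: E)
  have mE: "measure M (E t) = max 0 (1 - t)" if t: "0 \<le> t" for t
  proof -
    have bound: "\<bar>measure M (E t) - max 0 (1 - t)\<bar> \<le> 1 / 2 ^ n" for n
    proof -
      \<comment> \<open>k / 2 ^ n is the largest dyadic number of stage n not exceeding t, so
        \<open>E t\<close> lies between \<open>C n (Suc k)\<close> and \<open>C n k\<close>, whose
        measures differ by at most 1 / 2 ^ n.\<close>
      define k where "k = nat \<lfloor>t * 2 ^ n\<rfloor>"
      have "real k \<le> t * 2 ^ n" "t * 2 ^ n < real k + 1"
        using t by (auto simp: k_def)
      then have k: "real k / 2 ^ n \<le> t" "t < real (Suc k) / 2 ^ n" by (simp_all add: field_simps)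
      have "Suc k \<in> {j. t < real j / 2 ^ n}" using k by simp
      then have "C n (Suc k) \<subseteq> E t" unfolding E_def by blast
      then have "measure M (C n (Suc k)) \<le> measure M (E t)" by (intro finite_measure_mono) auto
      moreover have "E t \<subseteq> C n k"
        unfolding E_def using k by (intro UN_least mono) auto
      then have "measure M (E t) \<le> measure M (C n k)" by (intro finite_measure_mono) auto
      moreover have "real (Suc k) / 2 ^ n = real k / 2 ^ n + 1 / 2 ^ n" by (simp add: field_simps)
      moreover have "\<bar>E - max 0 (1 - t)\<bar> \<le> d"
        if "max 0 (1 - (a + d)) \<le> E" "E \<le> max 0 (1 - a)" "a \<le> t" "t < a + d" for E a d :: real
        using that by linarith
      ultimately show ?thesis using k unfolding meas by metis
    qed
    have "(\<lambda>n. 1 / 2 ^ n :: real) \<longlonglongrightarrow> 0"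
      using LIMSEQ_realpow_zero[of "1/2::real"] by (simp add: power_one_over)
    then have "\<bar>measure M (E t) - max 0 (1 - t)\<bar> \<le> 0"
      by (rule LIMSEQ_le_const) (use bound in auto)
    then show ?thesis by simp
  qed
  have "distr M borel V = uniform_measure lborel {0..1}"
  proof (rule measure_eqI_lessThan)
    fix t :: real
    have "emeasure (distr M borel V) {t<..} = emeasure M (E t)"
      by (simp add: emeasure_distr E[symmetric] vimage_def Int_def conj_commute)
    also have "\<dots> = ennreal (if t < 0 then 1 else max 0 (1 - t))"
    proof (cases "t < 0")
      case True
      have "C 0 0 \<subseteq> E t" using True by (auto simp: E_def intro!: exI[of _ 0])
      then have "E t = space M" using sets.sets_into_space[OF Em] by (auto simp: C_def)
      with True show ?thesis by (simp add: emeasure_space_1)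
    next
      case False
      then show ?thesis by (simp add: emeasure_eq_measure mE)
    qed
    also have "\<dots> = emeasure (uniform_measure lborel {0..1}) {t<..}"
    proof -
      have "{0..1} \<inter> {t<..} = (if t < 0 then {0..1} else {t<..1})" by auto
      then show ?thesis by (cases "t \<le> 1") (auto simp: max_def divide_ennreal_def)
    qed
    finally show "emeasure (distr M borel V) {t<..} = emeasure (uniform_measure lborel {0..1}) {t<..}" .
    show "emeasure (distr M borel V) {t<..} < \<infinity>"
      by (simp add: emeasure_distr emeasure_eq_measure)
  qed auto
  with V show ?thesis by (intro exI[of _ V] conjI)
qed

lemma (in prob_space) uniform_rv:
  assumes "nonatomic M"
  shows "uniform_rv M \<in> borel_measurable M" "distr M borel (uniform_rv M) = uniform_measure lborel {0..1}"
  using someI_ex[OF nonatomic_uniform_rv[OF assms]] unfolding uniform_rv_def by auto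

section \<open>Risk functionals of laws\<close>

lemma risk_under_tendsto:
  assumes M: "prob_space M" "nonatomic M" and \<rho>: "convex_risk_measure M p \<rho>" and p: "1 \<le> p"
    and Q: "\<And>n. prob_space (Qs n)" "prob_space Q"
    and Lp: "\<And>n. \<phi>s n \<in> Lp (Qs n) p" "\<phi> \<in> Lp Q p"
    and weak: "weak_conv_m (\<lambda>n. distr (Qs n) borel (\<phi>s n)) (distr Q borel \<phi>)"
    and moment: "(\<lambda>n. \<integral>x. \<bar>\<phi>s n x\<bar> powr p \<partial>Qs n) \<longlonglongrightarrow> (\<integral>x. \<bar>\<phi> x\<bar> powr p \<partial>Q)"
  shows "(\<lambda>n. risk_under M \<rho> (Qs n) (\<phi>s n)) \<longlonglongrightarrow> risk_under M \<rho> Q \<phi>"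
proof -
  note U = prob_space.uniform_rv[OF M]
  have dist: "real_distribution (distr (Qs n) borel (\<phi>s n))" "real_distribution (distr Q borel \<phi>)" for n
    using Lp LpD(1) Q by (auto intro!: prob_space.real_distribution_distr)
  show ?thesis
    unfolding risk_under_def induced_functional_def
  proof (rule convex_risk_measure_tendsto[OF \<rho> p])
    show "(\<lambda>n. \<integral>\<omega>. \<bar>quantile (distr (Qs n) borel (\<phi>s n)) (uniform_rv M \<omega>)
        - quantile (distr Q borel \<phi>) (uniform_rv M \<omega>)\<bar> powr p \<partial>M) \<longlonglongrightarrow> 0"
      using p moment
      by (intro Lp_tendsto_of_AE_tendsto AE_quantile_tendsto dist weak U quantile_in_Lp[OF _ U] Q Lp)
        (simp_all add: integral_quantile_powr[OF Q(1) U Lp(1)] integral_quantile_powr[OF Q(2) U Lp(2)])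
  qed (intro quantile_in_Lp[OF _ U] Q Lp)+
qed

lemma Lp_imp_integrable:
  assumes "prob_space Q" "1 \<le> p" "\<phi> \<in> Lp Q p"
  shows "integrable Q \<phi>"
proof (rule Bochner_Integration.integrable_bound[of Q "\<lambda>x. 1 + \<bar>\<phi> x\<bar> powr p"])
  interpret prob_space Q by fact
  show "integrable Q (\<lambda>x. 1 + \<bar>\<phi> x\<bar> powr p)" using LpD(2)[OF assms(3)] by simp
  have "\<bar>t\<bar> \<le> 1 + \<bar>t\<bar> powr p" for t :: real
  proof (cases "\<bar>t\<bar> \<le> 1")
    case True then show ?thesis by (simp add: add_increasing2)
  next
    case False
    then have "\<bar>t\<bar> powr 1 \<le> \<bar>t\<bar> powr p" using assms(2) by (intro powr_mono) auto
    then show ?thesis by simp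
  qed
  then show "AE x in Q. norm (\<phi> x) \<le> norm (1 + \<bar>\<phi> x\<bar> powr p)" by (simp add: abs_of_nonneg)
qed (rule LpD(1)[OF assms(3)])

lemma
  assumes M: "prob_space M" "nonatomic M" and Q: "prob_space Q"
    and Lp: "\<phi> \<in> Lp Q p" "\<psi> \<in> Lp Q p" and le: "AE x in Q. \<phi> x \<le> \<psi> x"
  shows risk_under_mono: "convex_risk_measure M p \<rho> \<Longrightarrow> risk_under M \<rho> Q \<phi> \<le> risk_under M \<rho> Q \<psi>"
    and risk_under_strict_mono: "strictly_monotone M p \<rho> \<Longrightarrow> 1 \<le> p \<Longrightarrow>
      risk_under M \<rho> Q \<psi> \<le> risk_under M \<rho> Q \<phi> \<Longrightarrow> AE x in Q. \<phi> x = \<psi> x"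
proof -
  interpret M: prob_space M by fact
  interpret Q: prob_space Q by fact
  note U = M.uniform_rv[OF M(2)]
  note m[measurable] = LpD(1)[OF Lp(1)] LpD(1)[OF Lp(2)] U(1)
  define q where "q \<xi> \<omega> = quantile (distr Q borel \<xi>) (uniform_rv M \<omega>)" for \<xi> \<omega>
  have q: "q \<phi> \<in> Lp M p" "q \<psi> \<in> Lp M p" unfolding q_def[abs_def] by (intro quantile_in_Lp[OF Q U] Lp)+
  note [measurable] = LpD(1)[OF q(1)] LpD(1)[OF q(2)]
  have qle: "AE \<omega> in M. q \<phi> \<omega> \<le> q \<psi> \<omega>" unfolding q_def by (intro AE_quantile_mono[OF Q U] m le)
  have r: "risk_under M \<rho> Q \<xi> = \<rho> (q \<xi>)" for \<xi>
    by (simp add: risk_under_def induced_functional_def q_def[abs_def])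
  show "convex_risk_measure M p \<rho> \<Longrightarrow> risk_under M \<rho> Q \<phi> \<le> risk_under M \<rho> Q \<psi>"
    using q qle unfolding r convex_risk_measure_def by blast
  assume \<rho>: "strictly_monotone M p \<rho>" and p: "1 \<le> p"
    and ge: "risk_under M \<rho> Q \<psi> \<le> risk_under M \<rho> Q \<phi>"
  have "\<not> 0 < measure M {\<omega> \<in> space M. q \<phi> \<omega> < q \<psi> \<omega>}"
    using \<rho> q qle ge unfolding r strictly_monotone_def by fastforce
  then have "AE \<omega> in M. \<not> q \<phi> \<omega> < q \<psi> \<omega>"
    by (subst AE_iff_measurable[OF _ refl]) (simp_all add: M.emeasure_eq_measure zero_less_measure_iff)
  with qle have qeq: "AE \<omega> in M. q \<phi> \<omega> = q \<psi> \<omega>" by eventually_elim simp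
  have "distr Q borel \<phi> = distr M borel (q \<phi>)"
    unfolding q_def[abs_def] using m by (intro distr_quantile_uniform[symmetric] U Q.real_distribution_distr)
  also have "\<dots> = distr M borel (q \<psi>)" using qeq by (intro distr_cong_AE) auto
  also have "\<dots> = distr Q borel \<psi>"
    unfolding q_def[abs_def] using m by (intro distr_quantile_uniform U Q.real_distribution_distr)
  finally have eq: "distr Q borel \<phi> = distr Q borel \<psi>" .
  \<comment> \<open>Equal laws say nothing pointwise on Q, since the coupling took place on M. Equal
    finite means do, together with the order of \<open>\<phi>\<close> and \<open>\<psi>\<close> on
    Q; p \<ge> 1 makes the means finite.\<close>
  have int: "integrable Q \<phi>" "integrable Q \<psi>"
    using Lp_imp_integrable[OF Q p] Lp by auto
  have "(\<integral>x. \<phi> x \<partial>Q) = (\<integral>t. t \<partial>distr Q borel \<phi>)" "(\<integral>x. \<psi> x \<partial>Q) = (\<integral>t. t \<partial>distr Q borel \<psi>)"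
    by (subst integral_distr; simp)+
  with eq int have "(\<integral>x. \<psi> x - \<phi> x \<partial>Q) = 0" by simp
  moreover have "AE x in Q. 0 \<le> \<psi> x - \<phi> x" using le by simp
  ultimately have "AE x in Q. \<psi> x - \<phi> x = 0"
    using integral_nonneg_eq_0_iff_AE[of Q "\<lambda>x. \<psi> x - \<phi> x"] int by auto
  then show "AE x in Q. \<phi> x = \<psi> x" by eventually_elim simp
qed

section \<open>Joint continuity of the conditional risk\<close>

text \<open>Continuity of the kernel into this topology thus forces its values to be moment
  measures, which is where the integrability of the weight comes from.\<close>

lemma topspace_norm_weak_topology: "topspace (norm_weak_topology q) \<subseteq> moment_measures q"
  unfolding norm_weak_topology_def by (auto simp: topology_generated_by_topspace)

lemma norm_weak_topology_integral_tendsto: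
  fixes \<kappa> :: "'a::metric_space \<Rightarrow> 'b::euclidean_space measure"
  assumes \<kappa>: "continuous_map (top_of_set X) (norm_weak_topology q) \<kappa>"
    and h: "h \<in> growth_functions q" and xs: "\<And>n. xs n \<in> X" "x \<in> X" "xs \<longlonglongrightarrow> x"
  shows "(\<lambda>n. \<integral>t. h t \<partial>\<kappa> (xs n)) \<longlonglongrightarrow> (\<integral>t. h t \<partial>\<kappa> x)"
proof (rule topological_tendstoI)
  fix U :: "real set" assume U: "open U" "(\<integral>t. h t \<partial>\<kappa> x) \<in> U"
  let ?V = "{\<mu> \<in> moment_measures q. (\<integral>t. h t \<partial>\<mu>) \<in> U}"
  have "openin (norm_weak_topology q) ?V"
    unfolding norm_weak_topology_def using h U by (intro topology_generated_by_Basis) blast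
  from openin_continuous_map_preimage[OF \<kappa> this]
  have "openin (top_of_set X) {x \<in> X. \<kappa> x \<in> ?V}" by simp
  then obtain T where T: "open T" "{x \<in> X. \<kappa> x \<in> ?V} = X \<inter> T" by (auto simp: openin_open)
  have "\<kappa> x \<in> moment_measures q"
    using continuous_map_image_subset_topspace[OF \<kappa>] topspace_norm_weak_topology[of q] xs by auto
  with U T xs have "x \<in> T" by blast
  with xs T have "\<forall>\<^sub>F n in sequentially. xs n \<in> T" by (auto dest: topological_tendstoD)
  then show "\<forall>\<^sub>F n in sequentially. (\<integral>t. h t \<partial>\<kappa> (xs n)) \<in> U"
    by eventually_elim (use T xs in blast)
qed

text \<open>The case \<open>q = 0\<close> is separate because \<open>norm y powr 0\<close> is discontinuous at the origin.\<close>

definition moment_weight :: "real \<Rightarrow> 'b::euclidean_space \<Rightarrow> real" where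
  "moment_weight q y = (if q = 0 then 2 else norm y powr q + 1)"

lemma moment_weight:
  fixes y :: "'b::euclidean_space"
  assumes "0 \<le> q"
  shows moment_weight_growth: "(moment_weight q :: 'b \<Rightarrow> real) \<in> growth_functions q"
    and moment_weight_ge: "norm y powr q + 1 \<le> moment_weight q y"
proof -
  have "continuous_on UNIV (moment_weight q :: 'b \<Rightarrow> real)"
    unfolding moment_weight_def[abs_def] using assms
    by (cases "q = 0") (auto intro!: continuous_intros continuous_on_powr')
  moreover have "\<bar>moment_weight q t\<bar> \<le> 2 * (norm t powr q + 1)" for t :: 'b
    by (auto simp: moment_weight_def)
  ultimately show "(moment_weight q :: 'b \<Rightarrow> real) \<in> growth_functions q"
    unfolding growth_functions_def by (auto intro!: exI[of _ "2::real"])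
  show "norm y powr q + 1 \<le> moment_weight q y" by (auto simp: moment_weight_def)
qed

lemma bounded_continuous_growth:
  assumes "continuous_on UNIV h" "\<And>t. \<bar>h t\<bar> \<le> B"
  shows "h \<in> growth_functions q"
proof -
  have "\<bar>h t\<bar> \<le> (\<bar>B\<bar> + 1) * (norm t powr q + 1)" for t
  proof -
    have "\<bar>h t\<bar> \<le> (\<bar>B\<bar> + 1) * 1" using assms(2)[of t] by simp
    also have "\<dots> \<le> (\<bar>B\<bar> + 1) * (norm t powr q + 1)" by (intro mult_left_mono) auto
    finally show ?thesis .
  qed
  with assms(1) show ?thesis unfolding growth_functions_def by (auto intro!: exI[of _ "\<bar>B\<bar> + 1"])
qed

text \<open>Here b stands for \<open>\<eta> z\<close> and B for a local bound of
  \<open>\<eta>\<close>, so the right-hand side is free of z. The p-th power turns the growth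
  exponent \<open>\<iota>\<close> into \<open>\<iota> * p\<close>, the exponent of the topology on
  the kernel.\<close>

lemma growth_bound_powr:
  fixes y :: "'b::euclidean_space"
  assumes p: "1 \<le> p" and \<iota>: "0 \<le> \<iota>" and B: "\<bar>v\<bar> \<le> b * (norm y powr \<iota> + 1)" "0 \<le> b" "b \<le> B"
  shows "\<bar>v\<bar> powr p \<le> (2 * B) powr p * moment_weight (\<iota> * p) y"
proof -
  have "\<bar>v\<bar> powr p \<le> (B * (norm y powr \<iota> + 1)) powr p"
    using p B by (intro powr_mono2 order_trans[OF B(1)] mult_right_mono) auto
  also have "\<dots> = B powr p * \<bar>norm y powr \<iota> + 1\<bar> powr p" using B by (simp add: powr_mult)
  also have "\<dots> \<le> B powr p * (2 powr p * (\<bar>norm y powr \<iota>\<bar> powr p + \<bar>1\<bar> powr p))"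
    using p by (intro mult_left_mono abs_add_powr_le) auto
  also have "\<dots> = (2 * B) powr p * (norm y powr (\<iota> * p) + 1)"
    using B by (simp add: powr_mult powr_powr)
  also have "\<dots> \<le> (2 * B) powr p * moment_weight (\<iota> * p) y"
    using moment_weight_ge[of "\<iota> * p" y] p \<iota> by (intro mult_left_mono) auto
  finally show ?thesis .
qed

text \<open>In the product filter n and y' vary independently, as the infimal convolution demands;
  separate continuity of \<open>c\<close> would not give this.\<close>

lemma continuous_on_tendsto_product_filter:
  fixes c :: "'c::topological_space \<Rightarrow> 'b::topological_space \<Rightarrow> real"
  assumes c: "continuous_on (Z \<times> Y) (\<lambda>(z, y). c z y)"
    and zs: "\<And>n. zs n \<in> Z" "z \<in> Z" "zs \<longlonglongrightarrow> z" and y: "y \<in> Y"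
  shows "((\<lambda>(n, y'). c (zs n) y') \<longlongrightarrow> c z y) (sequentially \<times>\<^sub>F inf (nhds y) (principal Y))"
proof -
  let ?F = "sequentially \<times>\<^sub>F inf (nhds y) (principal Y)"
  have "((\<lambda>(z, y). c z y) \<longlongrightarrow> (\<lambda>(z, y). c z y) (z, y)) (at (z, y) within Z \<times> Y)"
    using c zs y unfolding continuous_on_def by blast
  \<comment> \<open>The new filter includes the base point, which \<open>at within\<close> excludes;
    the function takes its limit value there.\<close>
  then have c': "((\<lambda>(z, y). c z y) \<longlongrightarrow> c z y) (inf (nhds (z, y)) (principal (Z \<times> Y)))"
    using tendsto_at_within_iff_tendsto_nhds[of "\<lambda>(z, y). c z y" "(z, y)" "Z \<times> Y"] by simp
  have fst: "((\<lambda>i. zs (fst i)) \<longlongrightarrow> z) ?F" by (rule filterlim_compose[OF zs(3) filterlim_fst])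
  have snd: "filterlim snd (inf (nhds y) (principal Y)) ?F" by (rule filterlim_snd)
  then have "(snd \<longlongrightarrow> y) ?F" "\<forall>\<^sub>F i in ?F. snd i \<in> Y" by (simp_all add: filterlim_inf filterlim_principal)
  with fst have "filterlim (\<lambda>i. (zs (fst i), snd i)) (inf (nhds (z, y)) (principal (Z \<times> Y))) ?F"
    using zs(1) by (auto simp: filterlim_inf filterlim_principal intro!: tendsto_Pair)
  from filterlim_compose[OF c' this] show ?thesis by (simp add: case_prod_beta')
qed

lemma extend_to_borel_integrals:
  fixes h :: "'b::euclidean_space \<Rightarrow> real"
  assumes "sets \<mu> = sets (borel_on S)" "h \<in> borel_measurable borel"
  shows "(\<integral>t. h t \<partial>extend_to_borel \<mu>) = (\<integral>t. h t \<partial>\<mu>)"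
    and "integrable (extend_to_borel \<mu>) h \<longleftrightarrow> integrable \<mu> h"
proof -
  have "(\<lambda>y. y) \<in> borel_measurable \<mu>" by (rule borel_on_measurable[OF _ assms(1)]) simp
  then show "(\<integral>t. h t \<partial>extend_to_borel \<mu>) = (\<integral>t. h t \<partial>\<mu>)"
    "integrable (extend_to_borel \<mu>) h \<longleftrightarrow> integrable \<mu> h"
    using assms(2) by (simp_all add: extend_to_borel_def integral_distr integrable_distr_eq)
qed

lemma growth_function_measurable: "h \<in> growth_functions q \<Longrightarrow> h \<in> borel_measurable borel"
  by (auto simp: growth_functions_def intro: borel_measurable_continuous_onI)

lemma moment_measures_integrable:
  assumes "\<mu> \<in> moment_measures q" "h \<in> growth_functions q"
  shows "integrable \<mu> h"
proof -
  obtain c0 where c0: "\<And>t. \<bar>h t\<bar> \<le> c0 * (norm t powr q + 1)" using assms(2) by (auto simp: growth_functions_def)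
  interpret prob_space \<mu> using assms(1) by (simp add: moment_measures_def)
  have "sets \<mu> = sets borel" using assms(1) by (simp add: moment_measures_def)
  then have meas: "h \<in> borel_measurable \<mu>"
    using growth_function_measurable[OF assms(2)] measurable_cong_sets[OF _ refl] by blast
  have "integrable \<mu> (\<lambda>t. c0 * (norm t powr q + 1))"
    using assms(1) by (auto simp: moment_measures_def)
  then show ?thesis using meas
    by (rule Bochner_Integration.integrable_bound) (simp add: order_trans[OF c0 abs_ge_self])
qed

lemma risk_under_kernel_tendsto:
  fixes K :: "'a::metric_space \<Rightarrow> 'b::euclidean_space measure" and c :: "'c::metric_space \<Rightarrow> 'b \<Rightarrow> real"
  assumes M: "prob_space M" "nonatomic M" and \<rho>: "convex_risk_measure M p \<rho>" and p: "1 \<le> p" and \<iota>: "0 \<le> \<iota>"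
    and K: "\<And>x. x \<in> X \<Longrightarrow> prob_space (K x)" "\<And>x. x \<in> X \<Longrightarrow> sets (K x) = sets (borel_on Y)"
    and K_cont: "continuous_map (top_of_set X) (norm_weak_topology (\<iota> * p)) (\<lambda>x. extend_to_borel (K x))"
    and c: "continuous_on (Z \<times> Y) (\<lambda>(z, y). c z y)"
    and eta: "locally_bounded_on Z \<eta>" "\<And>z. z \<in> Z \<Longrightarrow> 0 \<le> \<eta> z"
    and growth: "\<And>z y. z \<in> Z \<Longrightarrow> y \<in> Y \<Longrightarrow> \<bar>c z y\<bar> \<le> \<eta> z * (norm y powr \<iota> + 1)"
    and xs: "\<And>n. xs n \<in> X" "x \<in> X" "xs \<longlonglongrightarrow> x"
    and zs: "\<And>n. zs n \<in> Z" "z \<in> Z" "zs \<longlonglongrightarrow> z"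
  shows "(\<lambda>n. risk_under M \<rho> (K (xs n)) (c (zs n))) \<longlonglongrightarrow> risk_under M \<rho> (K x) (c z)"
proof -
  define q where "q = \<iota> * p"
  have q0: "0 \<le> q" using p \<iota> by (simp add: q_def)
  \<comment> \<open>\<open>\<eta>\<close> is bounded only near z, so a uniform majorant is available
    only from some index k on. Both sequences are shifted by k, and \<open>LIMSEQ_offset\<close>
    undoes the shift at the end.\<close>
  obtain V where V: "openin (top_of_set Z) V" "z \<in> V" "bounded (\<eta> ` V)"
    using eta(1) zs(2) unfolding locally_bounded_on_def by blast
  then obtain T where T: "open T" "V = Z \<inter> T" by (auto simp: openin_open)
  obtain B where B: "\<And>z'. z' \<in> V \<Longrightarrow> \<eta> z' \<le> B"
    using V(3) unfolding bounded_iff by (force dest: abs_le_D1)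
  have "\<forall>\<^sub>F n in sequentially. zs n \<in> T" using V(2) T by (intro topological_tendstoD[OF zs(3)]) auto
  then obtain k where k: "\<And>n. k \<le> n \<Longrightarrow> zs n \<in> T" unfolding eventually_sequentially by blast
  define u where "u n = xs (n + k)" for n
  define v where "v n = zs (n + k)" for n
  have u: "u n \<in> X" "u \<longlonglongrightarrow> x" for n unfolding u_def[abs_def] using xs by (auto intro: LIMSEQ_ignore_initial_segment)
  have v: "v n \<in> Z" "v n \<in> V" "v \<longlonglongrightarrow> z" for n
    unfolding v_def[abs_def] using zs T k by (auto intro: LIMSEQ_ignore_initial_segment)
  define w where "w = (\<lambda>y :: 'b. (2 * B) powr p * moment_weight q y)"
  have dom: "\<bar>c z' y\<bar> powr p \<le> w y" if "z' \<in> V" "y \<in> Y" for z' y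
  proof -
    have "z' \<in> Z" using that T by simp
    then show ?thesis
      unfolding w_def q_def using that B eta(2) by (intro growth_bound_powr[OF p \<iota> growth]) auto
  qed
  note weight = moment_weight_growth[OF q0, where 'b='b]
  have ext: "extend_to_borel (K x') \<in> moment_measures q" if "x' \<in> X" for x'
    using continuous_map_image_subset_topspace[OF K_cont] topspace_norm_weak_topology[of "\<iota> * p"] that
    unfolding q_def by auto
  have int: "integrable (K x') h" if "x' \<in> X" "h \<in> growth_functions q" for x' and h :: "'b \<Rightarrow> real"
    using moment_measures_integrable[OF ext[OF that(1)] that(2)]
    unfolding extend_to_borel_integrals(2)[OF K(2)[OF that(1)] growth_function_measurable[OF that(2)]] .
  have lim: "(\<lambda>n. \<integral>t. h t \<partial>K (u n)) \<longlonglongrightarrow> (\<integral>t. h t \<partial>K x)" if "h \<in> growth_functions q" for h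
    using norm_weak_topology_integral_tendsto[OF K_cont[folded q_def] that u(1) xs(2) u(2)]
    unfolding extend_to_borel_integrals(1)[OF K(2)[OF u(1)] growth_function_measurable[OF that]]
      extend_to_borel_integrals(1)[OF K(2)[OF xs(2)] growth_function_measurable[OF that]] .
  have w: "continuous_on UNIV w" "integrable (K x') w" "(\<lambda>n. \<integral>t. w t \<partial>K (u n)) \<longlonglongrightarrow> (\<integral>t. w t \<partial>K x)"
    if "x' \<in> X" for x'
    unfolding w_def using weight int[OF that weight] tendsto_mult[OF tendsto_const lim[OF weight]]
    by (auto simp: growth_functions_def intro!: continuous_intros)
  have meas: "c z' \<in> borel_measurable (borel_on Y)" if "z' \<in> Z" for z'
  proof (rule borel_measurable_continuous_on_restrict)
    have "continuous_on Y (\<lambda>y. (\<lambda>(z, y). c z y) (z', y))"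
      by (rule continuous_on_compose2[OF c]) (use that in \<open>auto intro!: continuous_intros\<close>)
    then show "continuous_on Y (c z')" by simp
  qed
  have measK: "c z' \<in> borel_measurable (K x')" if "z' \<in> Z" "x' \<in> X" for z' x'
    using meas[OF that(1)] by (simp add: measurable_cong_sets[OF K(2)[OF that(2)] refl])
  have sp: "space (K x') = Y" if "x' \<in> X" for x'
    using sets_eq_imp_space_eq[OF K(2)[OF that]] by (simp add: space_restrict_space)
  have Lp: "c z' \<in> Lp (K x') p" if "z' \<in> V" "x' \<in> X" for z' x'
  proof -
    have [measurable]: "c z' \<in> borel_measurable (K x')" using that T by (intro measK) auto
    have "integrable (K x') (\<lambda>y. \<bar>c z' y\<bar> powr p)"
      by (rule Bochner_Integration.integrable_bound[OF w(2)[OF that(2)]])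
        (use sp that in \<open>auto intro!: AE_I2 order_trans[OF dom[OF that(1)] abs_ge_self]\<close>)
    then show ?thesis by (simp add: Lp_def)
  qed
  have conv: "((\<lambda>(n, y'). \<Phi> (c (v n) y')) \<longlongrightarrow> \<Phi> (c z y)) (sequentially \<times>\<^sub>F inf (nhds y) (principal Y))"
    if "isCont \<Phi> (c z y)" "y \<in> Y" for \<Phi> :: "real \<Rightarrow> real" and y
    using isCont_tendsto_compose[OF that(1) continuous_on_tendsto_product_filter[OF c v(1) zs(2) v(3) that(2)]]
    by (simp add: case_prod_beta')
  \<comment> \<open>Two instances are wanted: \<open>\<bar>t\<bar> powr p\<close> with weight w for
    the moments, and bounded continuous test functions with constant weight 1 for weak
    convergence.\<close>
  have \<Phi>_lim: "(\<lambda>n. \<integral>y. \<Phi> (c (v n) y) \<partial>K (u n)) \<longlonglongrightarrow> (\<integral>y. \<Phi> (c z y) \<partial>K x)"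
    if \<Phi>: "\<And>t. isCont \<Phi> t" and W: "W \<in> growth_functions q"
      and bd: "\<And>z' y. z' \<in> V \<Longrightarrow> y \<in> Y \<Longrightarrow> \<bar>\<Phi> (c z' y)\<bar> \<le> W y" for \<Phi> W
  proof -
    have [measurable]: "\<Phi> \<in> borel_measurable borel"
      using \<Phi> by (intro borel_measurable_continuous_onI continuous_at_imp_continuous_on) auto
    show ?thesis
    proof (rule dominated_convergence_varying_measures[where S=Y and w=W])
      show "(\<lambda>n. \<integral>y. h y \<partial>K (u n)) \<longlonglongrightarrow> (\<integral>y. h y \<partial>K x)"
        if "continuous_on UNIV h" "\<And>y. \<bar>h y\<bar> \<le> B" for h :: "'b \<Rightarrow> real" and B
        using that by (intro lim bounded_continuous_growth)
      show "((\<lambda>(n, y'). \<Phi> (c (v n) y')) \<longlongrightarrow> \<Phi> (c z y)) (sequentially \<times>\<^sub>F inf (nhds y) (principal Y))"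
        if "y \<in> Y" for y using \<Phi> that by (rule conv)
      show "(\<lambda>y. \<Phi> (c (v n) y)) \<in> borel_measurable (borel_on Y)" for n
        using meas[OF v(1)] by measurable
      show "(\<lambda>y. \<Phi> (c z y)) \<in> borel_measurable (borel_on Y)"
        using meas[OF zs(2)] by measurable
      show "continuous_on UNIV W" using W by (simp add: growth_functions_def)
    qed (fact K(1)[OF u(1)] K(1)[OF xs(2)] K(2)[OF u(1)] K(2)[OF xs(2)] int[OF u(1) W] int[OF xs(2) W]
        lim[OF W] bd[OF v(2)] bd[OF V(2)])+
  qed
  have "(\<lambda>n. risk_under M \<rho> (K (u n)) (c (v n))) \<longlonglongrightarrow> risk_under M \<rho> (K x) (c z)"
  proof (rule risk_under_tendsto[OF M \<rho> p])
    have w_growth: "w \<in> growth_functions q"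
    proof -
      obtain c0 where c0: "0 < c0" "\<And>t :: 'b. \<bar>moment_weight q t\<bar> \<le> c0 * (norm t powr q + 1)"
        using weight by (auto simp: growth_functions_def)
      \<comment> \<open>\<open>?a\<close> vanishes when B = 0 while a growth constant must be
        positive, hence \<open>?a + 1\<close>.\<close>
      let ?a = "(2 * B) powr p"
      have "\<bar>w t\<bar> \<le> ((?a + 1) * c0) * (norm t powr q + 1)" for t
      proof -
        have "\<bar>w t\<bar> = ?a * \<bar>moment_weight q t\<bar>" by (simp add: w_def abs_mult)
        also have "\<dots> \<le> (?a + 1) * (c0 * (norm t powr q + 1))" using c0 by (intro mult_mono) auto
        finally show ?thesis by (simp add: mult.assoc)
      qed
      moreover have "0 < (?a + 1) * c0" using c0(1) by (simp add: add_nonneg_pos)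
      ultimately show ?thesis using w(1)[OF xs(2)]
        unfolding growth_functions_def mem_Collect_eq by (intro conjI exI[of _ "(?a + 1) * c0"] allI)
    qed
    show "(\<lambda>n. \<integral>y. \<bar>c (v n) y\<bar> powr p \<partial>K (u n)) \<longlonglongrightarrow> (\<integral>y. \<bar>c z y\<bar> powr p \<partial>K x)"
    proof (rule \<Phi>_lim[OF _ w_growth])
      show "isCont (\<lambda>t. \<bar>t\<bar> powr p) t" for t :: real
        using p unfolding isCont_def by (intro tendsto_powr' tendsto_rabs tendsto_ident_at tendsto_const) auto
    qed (use dom in auto)
    show "weak_conv_m (\<lambda>n. distr (K (u n)) borel (c (v n))) (distr (K x) borel (c z))"
    proof (rule integral_bdd_continuous_conv_imp_weak_conv)
      fix f :: "real \<Rightarrow> real" assume f: "\<And>t. isCont f t" "\<And>t. \<bar>f t\<bar> \<le> 1"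
      have [measurable]: "f \<in> borel_measurable borel"
        using f by (intro borel_measurable_continuous_onI continuous_at_imp_continuous_on) auto
      have "(\<lambda>n. \<integral>y. f (c (v n) y) \<partial>K (u n)) \<longlonglongrightarrow> (\<integral>y. f (c z y) \<partial>K x)"
        by (rule \<Phi>_lim[OF f(1) bounded_continuous_growth[of "\<lambda>_. 1" 1]]) (use f in auto)
      then show "(\<lambda>n. \<integral>t. f t \<partial>distr (K (u n)) borel (c (v n))) \<longlonglongrightarrow> (\<integral>t. f t \<partial>distr (K x) borel (c z))"
        using measK[OF v(1) u(1)] measK[OF zs(2) xs(2)] by (simp add: integral_distr)
    qed (rule prob_space.real_distribution_distr K(1) measK u(1) xs(2) v(1) zs(2))+
  qed (rule K(1) Lp u(1) xs(2) v(2) V(2))+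
  then show ?thesis unfolding u_def v_def by (rule LIMSEQ_offset)
qed

section \<open>Continuity of minimisers and the main theorem\<close>

text \<open>A Berge-type argument: the minimisers stay in a compact set by the level-set condition, and
  by joint continuity every limit point of them is a minimiser, hence the unique one.\<close>

lemma continuous_on_arg_min_on:
  fixes R :: "'a::metric_space \<Rightarrow> 'c::metric_space \<Rightarrow> real"
  assumes R: "\<And>xs x zs z. (\<And>n. xs n \<in> X) \<Longrightarrow> x \<in> X \<Longrightarrow> xs \<longlonglongrightarrow> x \<Longrightarrow>
      (\<And>n. zs n \<in> Z) \<Longrightarrow> z \<in> Z \<Longrightarrow> zs \<longlonglongrightarrow> z \<Longrightarrow> (\<lambda>n. R (xs n) (zs n)) \<longlonglongrightarrow> R x z"
    and level: "\<And>x0. x0 \<in> X \<Longrightarrow>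
      \<exists>\<kappa> Z0 U. compact Z0 \<and> Z0 \<subseteq> Z \<and> openin (top_of_set X) U \<and> x0 \<in> U \<and>
        (\<forall>x\<in>U. {z\<in>Z. R x z \<le> \<kappa>} \<noteq> {} \<and> {z\<in>Z. R x z \<le> \<kappa>} \<subseteq> Z0)"
    and unique: "\<And>x. x \<in> X \<Longrightarrow> \<exists>!z. is_arg_min (R x) (\<lambda>z. z \<in> Z) z"
  shows "continuous_on X (\<lambda>x. arg_min_on (R x) Z)"
    and "\<And>x. x \<in> X \<Longrightarrow> is_arg_min (R x) (\<lambda>z. z \<in> Z) (arg_min_on (R x) Z)"
proof -
  define m where "m x = arg_min_on (R x) Z" for x
  have m: "is_arg_min (R x) (\<lambda>z. z \<in> Z) (m x)" if "x \<in> X" for x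
    using unique[OF that] unfolding m_def arg_min_on_def arg_min_def by (metis someI)
  then show "\<And>x. x \<in> X \<Longrightarrow> is_arg_min (R x) (\<lambda>z. z \<in> Z) (arg_min_on (R x) Z)" by (simp add: m_def)
  have mZ: "m x \<in> Z" and mle: "z \<in> Z \<Longrightarrow> R x (m x) \<le> R x z" if "x \<in> X" for x z
    using m[OF that] by (auto simp: is_arg_min_def not_less)
  have "continuous_on X m"
  proof (rule continuous_on_sequentiallyI)
    fix u x assume u: "\<forall>n. u n \<in> X" "x \<in> X" "u \<longlonglongrightarrow> x"
    obtain \<kappa> Z0 U where L: "compact Z0" "Z0 \<subseteq> Z" "openin (top_of_set X) U" "x \<in> U"
      "\<forall>x'\<in>U. {z\<in>Z. R x' z \<le> \<kappa>} \<noteq> {} \<and> {z\<in>Z. R x' z \<le> \<kappa>} \<subseteq> Z0"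
      using level[OF u(2)] by (elim exE conjE) (rule that)
    have mZ0: "m x' \<in> Z0" if "x' \<in> U" for x'
    proof -
      have x': "x' \<in> X" using openin_imp_subset[OF L(3)] that by auto
      have lev: "{z\<in>Z. R x' z \<le> \<kappa>} \<noteq> {}" "{z\<in>Z. R x' z \<le> \<kappa>} \<subseteq> Z0" using L(5) that by simp_all
      \<comment> \<open>Any point of the level set caps the minimal value by
        \<open>\<kappa>\<close>, so the minimiser belongs to the level set too.\<close>
      from lev(1) obtain z where z: "z \<in> Z" "R x' z \<le> \<kappa>" by auto
      have "R x' (m x') \<le> \<kappa>" using mle[OF x' z(1)] z(2) by simp
      then show ?thesis using lev(2) mZ[OF x'] by auto
    qed
    obtain T where "open T" "U = X \<inter> T" using L(3) by (auto simp: openin_open)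
    then have ev: "\<forall>\<^sub>F n in sequentially. u n \<in> U"
      using topological_tendstoD[OF u(3), of T] L(4) u(1) by auto
    show "(\<lambda>n. m (u n)) \<longlonglongrightarrow> m x"
    proof (rule ccontr)
      assume "\<not> (\<lambda>n. m (u n)) \<longlonglongrightarrow> m x"
      then obtain e where e: "0 < e" "\<exists>\<^sub>F n in sequentially. e \<le> dist (m (u n)) (m x)"
        unfolding tendsto_iff by (force simp: frequently_def not_le)
      have "\<exists>n\<ge>k. u n \<in> U \<and> e \<le> dist (m (u n)) (m x)" for k
        using frequently_ex[OF frequently_eventually_frequently[OF e(2)
              eventually_conj[OF ev eventually_ge_at_top[of k]]]] by blast
      then obtain r where r: "\<And>k. k \<le> r k" "\<And>k. u (r k) \<in> U" "\<And>k. e \<le> dist (m (u (r k))) (m x)"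
        by metis
      have ur: "(\<lambda>k. u (r k)) \<longlonglongrightarrow> x"
        using r(1) by (intro filterlim_compose[OF u(3)] filterlim_at_top_mono[OF filterlim_ident]) auto
      have "seq_compact Z0" using L(1) by (simp add: compact_eq_seq_compact_metric)
      moreover have "\<forall>k. m (u (r k)) \<in> Z0" using mZ0[OF r(2)] by simp
      ultimately obtain z s where z: "z \<in> Z0" "strict_mono s" "((\<lambda>k. m (u (r k))) \<circ> s) \<longlonglongrightarrow> z"
        by (rule seq_compactE)
      have urs: "(\<lambda>k. u (r (s k))) \<longlonglongrightarrow> x"
        using LIMSEQ_subseq_LIMSEQ[OF ur z(2)] by (simp add: comp_def)
      have z': "z \<in> Z" "(\<lambda>k. m (u (r (s k)))) \<longlonglongrightarrow> z" using z L(2) by (auto simp: comp_def)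
      \<comment> \<open>The competitor z0 is kept fixed along the sequence, and joint continuity
        passes the inequality to the limit on both sides.\<close>
      have "R x z \<le> R x z0" if "z0 \<in> Z" for z0
      proof (rule LIMSEQ_le)
        show "(\<lambda>k. R (u (r (s k))) (m (u (r (s k))))) \<longlonglongrightarrow> R x z"
          using u mZ by (intro R urs z') auto
        show "(\<lambda>k. R (u (r (s k))) z0) \<longlonglongrightarrow> R x z0"
          using u that by (intro R urs tendsto_const) auto
        show "\<exists>N. \<forall>n\<ge>N. R (u (r (s n))) (m (u (r (s n)))) \<le> R (u (r (s n))) z0"
          using mle[OF spec[OF u(1)] that] by simp
      qed
      then have "is_arg_min (R x) (\<lambda>z. z \<in> Z) z" using z'(1) by (auto simp: is_arg_min_def not_less)
      then have "z = m x" using unique[OF u(2)] m[OF u(2)] by blast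
      then have "(\<lambda>k. dist (m (u (r (s k)))) (m x)) \<longlonglongrightarrow> 0" 
        using tendsto_dist[OF z'(2) tendsto_const[of "m x"]] by simp
      then have "e \<le> 0" using r(3) by (intro LIMSEQ_le_const) auto
      with e(1) show False by simp
    qed
  qed
  then show "continuous_on X (\<lambda>x. arg_min_on (R x) Z)" by (simp add: m_def[abs_def])
qed

lemma is_arg_min_le:
  fixes f :: "'a \<Rightarrow> 'b::linorder"
  shows "is_arg_min f P x \<Longrightarrow> P y \<Longrightarrow> f x \<le> f y"
  by (simp add: is_arg_min_linorder)

theorem theorem4p1:
  fixes M :: "'w measure" and N :: "'v measure"
    and \<X> :: "'a::euclidean_space set" and \<Y> :: "'b::euclidean_space set" and \<Z> :: "'c::euclidean_space set"
    and X :: "'v \<Rightarrow> 'a" and Y :: "'v \<Rightarrow> 'b"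
    and P :: "('a \<times> 'b) measure" and K :: "'a \<Rightarrow> 'b measure"
    and p \<iota> :: real and c :: "'c \<Rightarrow> 'b \<Rightarrow> real" and \<eta> :: "'c \<Rightarrow> real"
    and \<rho>1 \<rho>2 \<rho>EA :: "('w \<Rightarrow> real) \<Rightarrow> real"
  assumes M: "prob_space M" "nonatomic M"
    and spaces: "\<X> \<noteq> {}" "\<Y> \<noteq> {}" "\<Z> \<noteq> {}"
      "polish_subspace \<X>" "polish_subspace \<Y>" "polish_subspace \<Z>" "closed \<Z>"
    and XY: "prob_space N" "X \<in> N \<rightarrow>\<^sub>M borel_on \<X>" "Y \<in> N \<rightarrow>\<^sub>M borel_on \<Y>"
    and P: "P = distr N (borel_on \<X> \<Otimes>\<^sub>M borel_on \<Y>) (\<lambda>\<omega>. (X \<omega>, Y \<omega>))"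
    and K: "conditional_distribution \<X> \<Y> P K"
    and p: "1 \<le> p"
    and risk_measures:
      "convex_risk_measure M p \<rho>1" "law_invariant M p \<rho>1"
      "convex_risk_measure M p \<rho>2" "law_invariant M p \<rho>2"
      "convex_risk_measure M p \<rho>EA" "law_invariant M p \<rho>EA"
    and c_cont: "continuous_on (\<Z> \<times> \<Y>) (\<lambda>(z, y). c z y)"
    and iota: "0 \<le> \<iota>"
    and eta: "locally_bounded_on \<Z> \<eta>" "\<And>z. z \<in> \<Z> \<Longrightarrow> 0 \<le> \<eta> z"
    and c_growth: "\<And>z y. z \<in> \<Z> \<Longrightarrow> y \<in> \<Y> \<Longrightarrow> \<bar>c z y\<bar> \<le> \<eta> z * (norm y powr \<iota> + 1)"
    and K_cont: "continuous_map (top_of_set \<X>) (norm_weak_topology (\<iota> * p)) (\<lambda>x. extend_to_borel (K x))"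
    and level_sets: "\<And>x0. x0 \<in> \<X> \<Longrightarrow>
      \<exists>\<kappa> Z0 U. compact Z0 \<and> Z0 \<subseteq> \<Z> \<and> openin (top_of_set \<X>) U \<and> x0 \<in> U \<and>
        (\<forall>x\<in>U. {z\<in>\<Z>. risk_under M \<rho>2 (K x) (c z) \<le> \<kappa>} \<noteq> {} \<and>
                {z\<in>\<Z>. risk_under M \<rho>2 (K x) (c z) \<le> \<kappa>} \<subseteq> Z0)"
    and unique: "\<And>x. x \<in> \<X> \<Longrightarrow>
      \<exists>!z. is_arg_min (\<lambda>z. risk_under M \<rho>2 (K x) (c z)) (\<lambda>z. z \<in> \<Z>) z"
    and EA_moment: "\<And>g. g \<in> policies \<X> \<Z> \<Longrightarrow> (\<lambda>(x, y). c (g x) y) \<in> Lp P p"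
    and EP_moment: "\<And>g. g \<in> policies \<X> \<Z> \<Longrightarrow>
      (\<lambda>x. risk_under M \<rho>2 (K x) (c (g x))) \<in> Lp (fst_marginal \<X> P) p"
  shows
    "continuous_on \<X> (\<lambda>x. arg_min_on (\<lambda>z. risk_under M \<rho>2 (K x) (c z)) \<Z>)
     \<and>
     (contextually_consistent M p \<X> \<Y> \<Z> \<rho>EA \<rho>2 \<longrightarrow>
        (\<exists>g. is_arg_min (\<lambda>g. risk_under M \<rho>EA P (\<lambda>(x, y). c (g x) y)) (\<lambda>g. g \<in> policies \<X> \<Z>) g))
     \<and>
     (strictly_contextually_consistent M p \<X> \<Y> \<Z> \<rho>EA \<rho>2 \<longrightarrow>
        (\<forall>g. is_arg_min (\<lambda>g. risk_under M \<rho>EA P (\<lambda>(x, y). c (g x) y)) (\<lambda>g. g \<in> policies \<X> \<Z>) g \<longrightarrow>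
           (AE x in fst_marginal \<X> P.
              is_arg_min (\<lambda>z. risk_under M \<rho>2 (K x) (c z)) (\<lambda>z. z \<in> \<Z>) (g x))))
     \<and>
     (\<exists>g. is_arg_min (\<lambda>g. risk_under M \<rho>1 (fst_marginal \<X> P) (\<lambda>x. risk_under M \<rho>2 (K x) (c (g x))))
            (\<lambda>g. g \<in> policies \<X> \<Z>) g)
     \<and>
     (strictly_monotone M p \<rho>1 \<longrightarrow>
        (\<forall>g. is_arg_min (\<lambda>g. risk_under M \<rho>1 (fst_marginal \<X> P) (\<lambda>x. risk_under M \<rho>2 (K x) (c (g x))))
               (\<lambda>g. g \<in> policies \<X> \<Z>) g \<longrightarrow>
           (AE x in fst_marginal \<X> P.
              is_arg_min (\<lambda>z. risk_under M \<rho>2 (K x) (c z)) (\<lambda>z. z \<in> \<Z>) (g x))))"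
proof -
  define R where "R x z = risk_under M \<rho>2 (K x) (c z)" for x z
  define PX where "PX = fst_marginal \<X> P"
  define m where "m x = arg_min_on (R x) \<Z>" for x
  have Km: "K \<in> borel_on \<X> \<rightarrow>\<^sub>M prob_algebra (borel_on \<Y>)"
    using K by (simp add: conditional_distribution_def)
  have Kx: "prob_space (K x)" "sets (K x) = sets (borel_on \<Y>)" if "x \<in> \<X>" for x
    using measurable_space[OF Km, of x] that by (auto simp: space_prob_algebra space_restrict_space)
  have pair[measurable]: "(\<lambda>\<omega>. (X \<omega>, Y \<omega>)) \<in> N \<rightarrow>\<^sub>M borel_on \<X> \<Otimes>\<^sub>M borel_on \<Y>"
    using XY by measurable
  have P_prob: "prob_space P" unfolding P by (rule prob_space.prob_space_distr[OF XY(1) pair])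
  have P_sets: "sets P = sets (borel_on \<X> \<Otimes>\<^sub>M borel_on \<Y>)" by (simp add: P)
  have "fst \<in> P \<rightarrow>\<^sub>M borel_on \<X>" by (simp add: P)
  then have PX: "prob_space PX" unfolding PX_def fst_marginal_def by (rule prob_space.prob_space_distr[OF P_prob])
  have sp: "space PX = \<X>" by (simp add: PX_def fst_marginal_def space_restrict_space)
  have R_lim: "(\<lambda>n. R (xs n) (zs n)) \<longlonglongrightarrow> R x z"
    if "\<And>n. xs n \<in> \<X>" "x \<in> \<X>" "xs \<longlonglongrightarrow> x" "\<And>n. zs n \<in> \<Z>" "z \<in> \<Z>" "zs \<longlonglongrightarrow> z" for xs x zs z
    unfolding R_def
    by (rule risk_under_kernel_tendsto[OF M risk_measures(3) p iota _ _ K_cont c_cont eta(1)])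
      (fact Kx eta(2) c_growth that)+
  have argmin: "continuous_on \<X> (\<lambda>x. arg_min_on (R x) \<Z>)"
    "\<And>x. x \<in> \<X> \<Longrightarrow> is_arg_min (R x) (\<lambda>z. z \<in> \<Z>) (arg_min_on (R x) \<Z>)"
  proof -
    note level = level_sets[folded R_def] and uniq = unique[folded R_def]
    show "continuous_on \<X> (\<lambda>x. arg_min_on (R x) \<Z>)"
      by (rule continuous_on_arg_min_on(1)) (fact R_lim, fact level, fact uniq)
    show "is_arg_min (R x) (\<lambda>z. z \<in> \<Z>) (arg_min_on (R x) \<Z>)" if "x \<in> \<X>" for x
      by (rule continuous_on_arg_min_on(2)[OF _ _ _ that]) (fact R_lim, fact level, fact uniq)
  qed
  have m: "is_arg_min (R x) (\<lambda>z. z \<in> \<Z>) (m x)" if "x \<in> \<X>" for x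
    unfolding m_def using that by (rule argmin(2))
  have m_cont: "continuous_on \<X> m" using argmin(1) by (simp add: m_def[abs_def])
  \<comment> \<open>Continuity of the minimiser is what makes it admissible in (EA) and
    (EP).\<close>
  have m_pol: "m \<in> policies \<X> \<Z>"
    unfolding policies_def using m_cont m by (simp add: is_arg_min_def image_subset_iff)
  have le: "R x (m x) \<le> R x (g x)" if "g \<in> policies \<X> \<Z>" "x \<in> \<X>" for g x
  proof -
    have "g x \<in> \<Z>" using that by (auto simp: policies_def)
    with m[OF that(2)] show ?thesis by (simp add: is_arg_min_def not_less)
  qed
  have le_AE: "AE x in PX. R x (m x) \<le> R x (g x)" if "g \<in> policies \<X> \<Z>" for g
    using le[OF that] by (intro AE_I2) (simp add: sp)
  have R_Lp: "(\<lambda>x. R x (g x)) \<in> Lp PX p" if "g \<in> policies \<X> \<Z>" for g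
    using EP_moment[OF that] by (simp add: R_def PX_def)
  \<comment> \<open>With \<open>m\<close> in the role of \<open>g1\<close>, condition (A) holds in
    every context by pointwise minimality, so consistency compares \<open>m\<close> with each
    policy.\<close>
  have dominated: "contextually_dominated M p \<X> \<Y> \<Z> \<rho>2 P K c m g" if g: "g \<in> policies \<X> \<Z>" for g
    unfolding contextually_dominated_def
  proof (intro conjI)
    show "AE x in fst_marginal \<X> P. risk_under M \<rho>2 (K x) (c (m x)) \<le> risk_under M \<rho>2 (K x) (c (g x))"
      using le_AE[OF g] unfolding R_def PX_def .
  qed (fact P_prob P_sets K c_cont m_pol g EA_moment[OF m_pol] EA_moment[OF g])+
  have optimal: "AE x in PX. is_arg_min (R x) (\<lambda>z. z \<in> \<Z>) (g x)"
    if g: "g \<in> policies \<X> \<Z>" and eq: "AE x in PX. R x (m x) = R x (g x)" for g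
    using eq AE_space
  proof eventually_elim
    case (elim x)
    then have "x \<in> \<X>" by (simp add: sp)
    with g have "g x \<in> \<Z>" by (auto simp: policies_def)
    with elim(1) m[OF \<open>x \<in> \<X>\<close>] show ?case by (simp add: is_arg_min_def)
  qed
  have EA_ex: "\<exists>g. is_arg_min (\<lambda>g. risk_under M \<rho>EA P (\<lambda>(x, y). c (g x) y)) (\<lambda>g. g \<in> policies \<X> \<Z>) g"
    if consistent: "contextually_consistent M p \<X> \<Y> \<Z> \<rho>EA \<rho>2"
  proof -
    have "risk_under M \<rho>EA P (\<lambda>(x, y). c (m x) y) \<le> risk_under M \<rho>EA P (\<lambda>(x, y). c (g x) y)"
      if "g \<in> policies \<X> \<Z>" for g
      by (rule consistent[unfolded contextually_consistent_def, THEN spec[of _ P], THEN spec[of _ K],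
            THEN spec[of _ c], THEN spec[of _ m], THEN spec[of _ g], THEN mp, OF dominated[OF that]])
    with m_pol show ?thesis by (intro exI[of _ m]) (simp add: is_arg_min_def not_less)
  qed
  have EA_opt: "AE x in PX. is_arg_min (R x) (\<lambda>z. z \<in> \<Z>) (g x)"
    if strict: "strictly_contextually_consistent M p \<X> \<Y> \<Z> \<rho>EA \<rho>2"
      and g: "is_arg_min (\<lambda>g. risk_under M \<rho>EA P (\<lambda>(x, y). c (g x) y)) (\<lambda>g. g \<in> policies \<X> \<Z>) g" for g
  proof -
    have gp: "g \<in> policies \<X> \<Z>" using g by (simp add: is_arg_min_def)
    note [measurable] = LpD(1)[OF R_Lp[OF gp]] LpD(1)[OF R_Lp[OF m_pol]]
    define A where "A = {x \<in> space PX. R x (m x) < R x (g x)}"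
    \<comment> \<open>Measurability of the conditional risks is part of the moment convention for
      (EP).\<close>
    have A: "A \<in> sets PX" unfolding A_def by measurable
    have "\<not> 0 < emeasure PX A"
    proof
      assume "0 < emeasure PX A"
      with A have ex: "\<exists>A\<in>sets (fst_marginal \<X> P). 0 < emeasure (fst_marginal \<X> P) A \<and>
          (\<forall>x\<in>A. risk_under M \<rho>2 (K x) (c (m x)) < risk_under M \<rho>2 (K x) (c (g x)))"
        by (intro bexI[of _ A]) (auto simp: A_def PX_def R_def)
      note less = strict[unfolded strictly_contextually_consistent_def, THEN conjunct2,
          THEN spec[of _ P], THEN spec[of _ K], THEN spec[of _ c], THEN spec[of _ m], THEN spec[of _ g]]
      have "risk_under M \<rho>EA P (\<lambda>(x, y). c (m x) y) < risk_under M \<rho>EA P (\<lambda>(x, y). c (g x) y)"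
        by (rule less[THEN mp, OF conjI[OF dominated[OF gp] ex]])
      moreover have "risk_under M \<rho>EA P (\<lambda>(x, y). c (g x) y) \<le> risk_under M \<rho>EA P (\<lambda>(x, y). c (m x) y)"
        by (rule is_arg_min_le[OF g, OF m_pol])
      ultimately show False by simp
    qed
    then have "A \<in> null_sets PX" using A by auto
    from AE_not_in[OF this] AE_space have "AE x in PX. R x (m x) = R x (g x)"
    proof eventually_elim
      case (elim x)
      then show ?case using le[OF gp, of x] by (auto simp: A_def sp)
    qed
    with gp show ?thesis by (rule optimal)
  qed
  \<comment> \<open>In the nested problem pointwise minimality passes through the outer risk measure
    by its monotonicity.\<close>
  have mono: "risk_under M \<rho>1 PX (\<lambda>x. R x (m x)) \<le> risk_under M \<rho>1 PX (\<lambda>x. R x (g x))"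
    if g: "g \<in> policies \<X> \<Z>" for g
    by (rule risk_under_mono[OF M PX R_Lp[OF m_pol] R_Lp[OF g] le_AE[OF g] risk_measures(1)])
  then have EP_ex: "\<exists>g. is_arg_min (\<lambda>g. risk_under M \<rho>1 PX (\<lambda>x. R x (g x))) (\<lambda>g. g \<in> policies \<X> \<Z>) g"
    using m_pol by (intro exI[of _ m]) (simp add: is_arg_min_def not_less)
  have EP_opt: "AE x in PX. is_arg_min (R x) (\<lambda>z. z \<in> \<Z>) (g x)"
    if strict: "strictly_monotone M p \<rho>1"
      and g: "is_arg_min (\<lambda>g. risk_under M \<rho>1 PX (\<lambda>x. R x (g x))) (\<lambda>g. g \<in> policies \<X> \<Z>) g" for g
  proof -
    have gp: "g \<in> policies \<X> \<Z>" using g by (simp add: is_arg_min_def)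
    have "risk_under M \<rho>1 PX (\<lambda>x. R x (g x)) \<le> risk_under M \<rho>1 PX (\<lambda>x. R x (m x))"
      by (rule is_arg_min_le[OF g, OF m_pol])
    then have "AE x in PX. R x (m x) = R x (g x)"
      by (rule risk_under_strict_mono[OF M PX R_Lp[OF m_pol] R_Lp[OF gp] le_AE[OF gp] strict p])
    with gp show ?thesis by (rule optimal)
  qed
  show ?thesis
  proof (intro conjI impI allI)
  qed (rule argmin(1)[unfolded R_def], erule EA_ex, erule (1) EA_opt[unfolded R_def PX_def],
      rule EP_ex[unfolded R_def PX_def], erule (1) EP_opt[unfolded R_def PX_def])
qed

end
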